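(* Let $\xi=(\xi_t)_{t\in[0,T]}\in L^2(\Omega\times[0,T],\mathbb{P}_u\otimes\mu)$ be such that $\xi_t\in\mathrm{Dom}(\nabla)$ for all $t\in[0,T]$ and $(D_t\xi_t)_{t\in[0,T]}\in L^1(\Omega\times[0,T],\mathbb{P}_u\otimes\mu)$. Then the quantity $$\mathrm{SURE}_\mu(X+\xi):=\int_0^T\gamma(t,t)\,\mu(dt)+\|\xi\|^2_{L^2([0,T],d\mu)}+2\int_0^T D_t\xi_t\,\mu(dt)$$ is an unbiased estimator of the mean square risk $\|X+\xi-u\|^2_{L^2([0,T],d\mu)}$, i.e. $$\mathbb{E}_u\big[\|X+\xi-u\|^2_{L^2([0,T],d\mu)}\big]=\mathbb{E}_u\big[\mathrm{SURE}_\mu(X+\xi)\big].$$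
   Context: Let $T>0$. Under a probability measure $\mathbb{P}_u$ (with expectation $\mathbb{E}_u$) on $\Omega$ one observes a (jointly measurable) real process $X=(X_t)_{t\in[0,T]}$ decomposed as $X_t=u_t+X^u_t$, where $u=(u_t)_{t\in[0,T]}$ is a square-integrable process adapted to the filtration generated by $X$, and $X^u=(X^u_t)_{t\in[0,T]}$ is a centered Gaussian process with non-vanishing covariance function $\gamma(s,t)=\mathbb{E}_u[X^u_sX^u_t]$. Let $\mu$ be a finite Borel measure on $[0,T]$ with $\int_0^T\gamma(t,t)\mu(dt)<\infty$. Gradient operators. Let $(\Gamma g)(t)=\int_0^Tg(s)\gamma(s,t)\mu(ds)$, $t\in[0,T]$, and let $H$ be the Hilbert space of functions on $[0,T]$ with inner product $\langle h,g\rangle_H=\langle h,\Gamma g\rangle_{L^2([0,T],d\mu)}$ (obtained from $L^2([0,T],d\mu)$ by passing to the quotient and completing). Let $X^u(h)=\int_0^TX^u_s h(s)\mu(ds)$; since $\mathbb{E}_u[X^u(h)X^u(g)]=\langle h,g\rangle_H$, the map $h\mapsto X^u(h)$ extends to an isometry $H\to L^2(\Omega,\mathbb{P}_u)$. The operator $\Gamma$ extends to $H$ by $(\Gamma h)(t)=\mathbb{E}_u[X^u(h)X^u_t]$. For cylindrical functionals $F=f_n(X^u(h_1),\dots,X^u(h_n))$, with $h_i\in H$ and $f_n$ infinitely differentiable and rapidly decreasing on $\mathbb{R}^n$, the $H$-valued Malliavin derivative is $\nabla F=\sum_{i=1}^n h_i\,\partial_if_n(X^u(h_1),\dots,X^u(h_n))$.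 The operator $\nabla$ is closable from $L^2(\Omega,\mathbb{P}_u)$ to $L^2(\Omega,\mathbb{P}_u;H)$; $\mathrm{Dom}(\nabla)$ denotes its closed domain. For $F\in\mathrm{Dom}(\nabla)$, set $D_tF:=(\Gamma\nabla F)(t)$, $t\in[0,T]$. *)

theory Defs
  imports "HOL-Probability.Probability"
begin

definition L2 :: "'a measure \<Rightarrow> ('a \<Rightarrow> 'b::{real_normed_vector,second_countable_topology}) set" where
  "L2 M = {f. f \<in> borel_measurable M \<and> integrable M (\<lambda>x. (norm (f x))\<^sup>2)}"

definition L2_sqnorm :: "'a measure \<Rightarrow> ('a \<Rightarrow> 'b::{real_normed_vector,second_countable_topology}) \<Rightarrow> real" where
  "L2_sqnorm M f = (\<integral>x. (norm (f x))\<^sup>2 \<partial>M)"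

definition natural_filtration :: "'w measure \<Rightarrow> (real \<Rightarrow> 'w \<Rightarrow> real) \<Rightarrow> real \<Rightarrow> 'w measure" where
  "natural_filtration P X t =
     sigma (space P) {X s -` A \<inter> space P | s A. s \<in> {0..t} \<and> A \<in> sets borel}"

text \<open>Constants count as (degenerate) Gaussian random variables.\<close>

definition gaussian_rv :: "'w measure \<Rightarrow> ('w \<Rightarrow> real) \<Rightarrow> bool" where
  "gaussian_rv P Y \<longleftrightarrow> Y \<in> borel_measurable P \<and>
     ((\<exists>m. AE \<omega> in P. Y \<omega> = m) \<or>
      (\<exists>m \<sigma>. 0 < \<sigma> \<and> distributed P lborel Y (normal_density m \<sigma>)))"

definition centered_gaussian_process ::
    "'w measure \<Rightarrow> real set \<Rightarrow> (real \<Rightarrow> 'w \<Rightarrow> real) \<Rightarrow> bool" where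
  "centered_gaussian_process P S Z \<longleftrightarrow>
     (\<forall>I c. finite I \<and> I \<subseteq> S \<longrightarrow> gaussian_rv P (\<lambda>\<omega>. \<Sum>t\<in>I. c t * Z t \<omega>)) \<and>
     (\<forall>t\<in>S. (\<integral>\<omega>. Z t \<omega> \<partial>P) = 0)"

text \<open>The covariance function of a centered process.\<close>

definition cov :: "'w measure \<Rightarrow> (real \<Rightarrow> 'w \<Rightarrow> real) \<Rightarrow> real \<Rightarrow> real \<Rightarrow> real" where
  "cov P Z s t = (\<integral>\<omega>. Z s \<omega> * Z t \<omega> \<partial>P)"

definition Gamma_op :: "real measure \<Rightarrow> (real \<Rightarrow> real \<Rightarrow> real) \<Rightarrow> (real \<Rightarrow> real) \<Rightarrow> real \<Rightarrow> real" where
  "Gamma_op \<mu> \<gamma> g t = (\<integral>s. g s * \<gamma> s t \<partial>\<mu>)"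

text \<open>
  The Hilbert space \<open>H\<close> is determined up to isometric isomorphism: it is a complete inner product
  space \<open>'h\<close> together with the canonical map \<open>J\<close> from \<open>L2 \<mu>\<close>, which is linear, has dense range and
  turns the semi-inner product \<open>\<langle>f, \<Gamma> g\<rangle>\<close> of \<open>L2 \<mu>\<close> into the inner product of \<open>'h\<close>. In particular
  \<open>J\<close> annihilates exactly the functions that are factored out by passing to the quotient.
  The sort constraint second_countable_topology excludes nothing, since \<open>L2 \<mu>\<close> is separable for
  a finite Borel measure \<open>\<mu>\<close> on an interval.
\<close>

definition is_H_space ::
    "real measure \<Rightarrow> (real \<Rightarrow> real \<Rightarrow> real) \<Rightarrow>
     ((real \<Rightarrow> real) \<Rightarrow> 'h::{real_inner,banach,second_countable_topology}) \<Rightarrow> bool" where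
  "is_H_space \<mu> \<gamma> J \<longleftrightarrow>
     (\<forall>f\<in>L2 \<mu>. \<forall>g\<in>L2 \<mu>. J (\<lambda>t. f t + g t) = J f + J g) \<and>
     (\<forall>f\<in>L2 \<mu>. \<forall>a. J (\<lambda>t. a * f t) = a *\<^sub>R J f) \<and>
     (\<forall>f\<in>L2 \<mu>. \<forall>g\<in>L2 \<mu>. J f \<bullet> J g = (\<integral>t. f t * Gamma_op \<mu> \<gamma> g t \<partial>\<mu>)) \<and>
     closure (J ` L2 \<mu>) = UNIV"

definition smoothed :: "real measure \<Rightarrow> (real \<Rightarrow> 'w \<Rightarrow> real) \<Rightarrow> (real \<Rightarrow> real) \<Rightarrow> 'w \<Rightarrow> real" where
  "smoothed \<mu> Z h \<omega> = (\<integral>s. Z s \<omega> * h s \<partial>\<mu>)"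

text \<open>
  A version of \<open>Z(h)\<close> for \<open>h\<close> in the completion: the limit in \<open>L2 P\<close> of \<open>Z(h\<^sub>k)\<close> for functions
  \<open>h\<^sub>k\<close> whose classes tend to \<open>h\<close>. By the isometry property, any two such limits agree almost surely.
\<close>

definition isonormal ::
    "'w measure \<Rightarrow> real measure \<Rightarrow> (real \<Rightarrow> 'w \<Rightarrow> real) \<Rightarrow>
     ((real \<Rightarrow> real) \<Rightarrow> 'h::{real_inner,banach,second_countable_topology}) \<Rightarrow> 'h \<Rightarrow> 'w \<Rightarrow> real" where
  "isonormal P \<mu> Z J h =
     (SOME Y. Y \<in> L2 P \<and>
        (\<exists>hs. (\<forall>k. hs k \<in> L2 \<mu>) \<and> (\<lambda>k. J (hs k)) \<longlonglongrightarrow> h \<and>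
              (\<lambda>k. L2_sqnorm P (\<lambda>\<omega>. smoothed \<mu> Z (hs k) \<omega> - Y \<omega>)) \<longlonglongrightarrow> 0))"

definition Gamma_ext ::
    "'w measure \<Rightarrow> real measure \<Rightarrow> (real \<Rightarrow> 'w \<Rightarrow> real) \<Rightarrow>
     ((real \<Rightarrow> real) \<Rightarrow> 'h::{real_inner,banach,second_countable_topology}) \<Rightarrow> 'h \<Rightarrow> real \<Rightarrow> real" where
  "Gamma_ext P \<mu> Z J h t = (\<integral>\<omega>. isonormal P \<mu> Z J h \<omega> * Z t \<omega> \<partial>P)"

text \<open>
  A function on \<open>\<real>\<^sup>n\<close> is encoded as a function of a sequence that depends only on the coordinates
  \<open>0, \<dots>, n - 1\<close>; continuity refers to the product topology, which for such functions is continuity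
  on \<open>\<real>\<^sup>n\<close>.
\<close>

definition partial_deriv :: "nat \<Rightarrow> ((nat \<Rightarrow> real) \<Rightarrow> real) \<Rightarrow> (nat \<Rightarrow> real) \<Rightarrow> real" where
  "partial_deriv i f x = deriv (\<lambda>y. f (x(i := y))) (x i)"

text \<open>
  Infinitely differentiable and rapidly decreasing on \<open>\<real>\<^sup>n\<close>, i.e. membership in the Schwartz space:
  all iterated partial derivatives exist, are continuous, and decay faster than any power.
\<close>

definition schwartz :: "nat \<Rightarrow> ((nat \<Rightarrow> real) \<Rightarrow> real) \<Rightarrow> bool" where
  "schwartz n f \<longleftrightarrow>
     (\<forall>x y. (\<forall>i<n. x i = y i) \<longrightarrow> f x = f y) \<and>
     (\<forall>is. set is \<subseteq> {..<n} \<longrightarrow>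
        (\<forall>i<n. \<forall>x. (\<lambda>y. foldr partial_deriv is f (x(i := y))) field_differentiable (at (x i))) \<and>
        continuous_on UNIV (foldr partial_deriv is f) \<and>
        (\<forall>k. \<exists>C. \<forall>x. (1 + (\<Sum>i<n. \<bar>x i\<bar>)) ^ k * \<bar>foldr partial_deriv is f x\<bar> \<le> C))"

text \<open>The graph of the Malliavin derivative on cylindrical functionals.\<close>

definition cylindrical_gradient ::
    "'w measure \<Rightarrow> real measure \<Rightarrow> (real \<Rightarrow> 'w \<Rightarrow> real) \<Rightarrow>
     ((real \<Rightarrow> real) \<Rightarrow> 'h::{real_inner,banach,second_countable_topology}) \<Rightarrow>
     ('w \<Rightarrow> real) \<Rightarrow> ('w \<Rightarrow> 'h) \<Rightarrow> bool" where
  "cylindrical_gradient P \<mu> Z J F G \<longleftrightarrow>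
     (\<exists>n\<ge>1. \<exists>f h. schwartz n f \<and>
        F = (\<lambda>\<omega>. f (\<lambda>i. isonormal P \<mu> Z J (h i) \<omega>)) \<and>
        G = (\<lambda>\<omega>. \<Sum>i<n. partial_deriv i f (\<lambda>j. isonormal P \<mu> Z J (h j) \<omega>) *\<^sub>R h i))"

text \<open>
  The closure of that graph in \<open>L2 P \<times> L2(P; H)\<close>. Since the derivative is closable, the closure
  determines \<open>G\<close> almost surely from \<open>F\<close>, so that the choice in \<open>nabla\<close> is one of a version.
\<close>

definition is_gradient ::
    "'w measure \<Rightarrow> real measure \<Rightarrow> (real \<Rightarrow> 'w \<Rightarrow> real) \<Rightarrow>
     ((real \<Rightarrow> real) \<Rightarrow> 'h::{real_inner,banach,second_countable_topology}) \<Rightarrow>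
     ('w \<Rightarrow> real) \<Rightarrow> ('w \<Rightarrow> 'h) \<Rightarrow> bool" where
  "is_gradient P \<mu> Z J F G \<longleftrightarrow> F \<in> L2 P \<and> G \<in> L2 P \<and>
     (\<exists>Fs Gs. (\<forall>k. cylindrical_gradient P \<mu> Z J (Fs k) (Gs k)) \<and>
        (\<lambda>k. L2_sqnorm P (\<lambda>\<omega>. Fs k \<omega> - F \<omega>)) \<longlonglongrightarrow> 0 \<and>
        (\<lambda>k. L2_sqnorm P (\<lambda>\<omega>. Gs k \<omega> - G \<omega>)) \<longlonglongrightarrow> 0)"

definition Dom_nabla ::
    "'w measure \<Rightarrow> real measure \<Rightarrow> (real \<Rightarrow> 'w \<Rightarrow> real) \<Rightarrow>
     ((real \<Rightarrow> real) \<Rightarrow> 'h::{real_inner,banach,second_countable_topology}) \<Rightarrow> ('w \<Rightarrow> real) set" where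
  "Dom_nabla P \<mu> Z J = {F. \<exists>G. is_gradient P \<mu> Z J F G}"

definition nabla ::
    "'w measure \<Rightarrow> real measure \<Rightarrow> (real \<Rightarrow> 'w \<Rightarrow> real) \<Rightarrow>
     ((real \<Rightarrow> real) \<Rightarrow> 'h::{real_inner,banach,second_countable_topology}) \<Rightarrow>
     ('w \<Rightarrow> real) \<Rightarrow> 'w \<Rightarrow> 'h" where
  "nabla P \<mu> Z J F = (SOME G. is_gradient P \<mu> Z J F G)"

definition D_op ::
    "'w measure \<Rightarrow> real measure \<Rightarrow> (real \<Rightarrow> 'w \<Rightarrow> real) \<Rightarrow>
     ((real \<Rightarrow> real) \<Rightarrow> 'h::{real_inner,banach,second_countable_topology}) \<Rightarrow>
     real \<Rightarrow> ('w \<Rightarrow> real) \<Rightarrow> 'w \<Rightarrow> real" where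
  "D_op P \<mu> Z J t F \<omega> = Gamma_ext P \<mu> Z J (nabla P \<mu> Z J F \<omega>) t"

text \<open>Here \<open>D\<xi>\<close> stands for (a version of) the process \<open>t \<mapsto> D\<^sub>t \<xi>\<^sub>t\<close>.\<close>

definition SURE ::
    "real measure \<Rightarrow> (real \<Rightarrow> real \<Rightarrow> real) \<Rightarrow> (real \<Rightarrow> 'w \<Rightarrow> real) \<Rightarrow> (real \<Rightarrow> 'w \<Rightarrow> real) \<Rightarrow> 'w \<Rightarrow> real" where
  "SURE \<mu> \<gamma> \<xi> D\<xi> \<omega> =
     (\<integral>t. \<gamma> t t \<partial>\<mu>) + L2_sqnorm \<mu> (\<lambda>t. \<xi> t \<omega>) + 2 * (\<integral>t. D\<xi> t \<omega> \<partial>\<mu>)"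

end

theory Submission
  imports Defs
begin

text \<open>
  The estimation error is \<open>X + \<xi> - u = Xu + \<xi>\<close>. Expanding its square and exchanging expectation
  and time integral, the trace of the covariance and the norm of \<open>\<xi>\<close> appear at once, and what
  remains is to identify the cross term: for every \<open>t\<close>,
  \<open>E[Xu\<^sub>t F] = E[D\<^sub>t F]\<close> for all \<open>F\<close> in the domain of the gradient (lemma \<open>integration_by_parts\<close>),
  applied to \<open>F = \<xi>\<^sub>t\<close>.

  Both sides of this identity are continuous in the graph norm of the gradient: the left one by the
  Cauchy-Schwarz inequality, the right one because \<open>h \<mapsto> (\<Gamma> h)(t) = E[Xu(h) Xu\<^sub>t]\<close> is a bounded
  linear functional on \<open>H\<close> (lemma \<open>Gamma_ext_bounded_linear\<close>). So it suffices to treat cylindrical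
  functionals \<open>F = f(Xu(h\<^sub>1), \<dots>, Xu(h\<^sub>n))\<close>, where it becomes the Gaussian integration by parts formula
  \<open>E[Y\<^sub>0 f(Y)] = \<Sum>\<^sub>i E[Y\<^sub>0 Y\<^sub>i] E[\<partial>\<^sub>i f(Y)]\<close> with \<open>Y\<^sub>0 = Xu\<^sub>t\<close> and \<open>Y\<^sub>i = Xu(h\<^sub>i)\<close>
  (lemma \<open>gaussian_integration_by_parts\<close>). The formula must be used in this form, with \<open>Y\<^sub>0\<close> a general
  Gaussian variable, since evaluation at \<open>t\<close> need not be represented by an element of \<open>H\<close>.

  To apply the formula, all the variables must be jointly Gaussian. They lie in the closed
  linear span of the \<open>Xu\<^sub>s\<close> in \<open>L\<^sup>2\<close>, which consists of centered Gaussian variables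
  (lemma \<open>gaussian_space_char\<close>); that the time integrals \<open>\<integral> Xu\<^sub>s h(s) \<mu>(ds)\<close> belong to it follows from a
  projection argument (lemma \<open>smoothed_in_gaussian_space\<close>).

  The formula itself reduces to one dimension. Normalise \<open>Y\<^sub>0\<close> to \<open>U\<close> and write
  \<open>Y\<^sub>i = b\<^sub>i U + R\<^sub>i\<close> with \<open>R\<^sub>i\<close> orthogonal to \<open>U\<close>. Then \<open>U\<close> is independent of the sequence \<open>R\<close>, and
  Stein's identity \<open>E[U g(U)] = E[g'(U)]\<close> can be applied along the line \<open>u \<mapsto> f(R + u b)\<close> with \<open>R\<close> held fixed.
  Independence comes from the factorisation of the joint characteristic function
  (lemma \<open>joint_law_eq_product\<close>); the uniqueness theorem in several variables that this requires is
  obtained from Levy's theorem on the line by removing one coordinate at a time.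
\<close>

section \<open>Square-integrable functions\<close>

lemma L2_measurable: "f \<in> L2 M \<Longrightarrow> f \<in> borel_measurable M"
  by (simp add: L2_def)

lemma L2_sq_integrable: "f \<in> L2 M \<Longrightarrow> integrable M (\<lambda>x. (norm (f x))\<^sup>2)"
  by (simp add: L2_def)

lemma L2_sqnorm_nonneg: "0 \<le> L2_sqnorm M f"
  by (simp add: L2_sqnorm_def)

lemma norm_add_sq_le:
  fixes a b :: "'a::real_normed_vector"
  shows "(norm (a + b))\<^sup>2 \<le> 2 * (norm a)\<^sup>2 + 2 * (norm b)\<^sup>2"
proof -
  have "(norm (a + b))\<^sup>2 \<le> (norm a + norm b)\<^sup>2"
    by (intro power_mono norm_triangle_ineq norm_ge_zero)
  also have "\<dots> \<le> 2 * (norm a)\<^sup>2 + 2 * (norm b)\<^sup>2"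
    using sum_squares_bound[of "norm a" "norm b"] by (simp add: power2_sum)
  finally show ?thesis .
qed

lemma L2_add:
  fixes f g :: "'a \<Rightarrow> 'b::{real_normed_vector,second_countable_topology}"
  assumes f: "f \<in> L2 M" and g: "g \<in> L2 M"
  shows "(\<lambda>x. f x + g x) \<in> L2 M"
proof -
  note [measurable] = L2_measurable[OF f] L2_measurable[OF g]
  have "integrable M (\<lambda>x. (norm (f x + g x))\<^sup>2)"
    by (rule Bochner_Integration.integrable_bound[of M "\<lambda>x. 2 * (norm (f x))\<^sup>2 + 2 * (norm (g x))\<^sup>2"])
       (use L2_sq_integrable[OF f] L2_sq_integrable[OF g] norm_add_sq_le in auto)
  then show ?thesis by (simp add: L2_def)
qed

lemma L2_scaleR:
  fixes f :: "'a \<Rightarrow> 'b::{real_normed_vector,second_countable_topology}"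
  assumes "f \<in> L2 M"
  shows "(\<lambda>x. c *\<^sub>R f x) \<in> L2 M"
  using assms by (auto simp: L2_def power_mult_distrib)

lemma L2_cmult:
  fixes f :: "'a \<Rightarrow> real"
  shows "f \<in> L2 M \<Longrightarrow> (\<lambda>x. c * f x) \<in> L2 M"
  using L2_scaleR[of f M c] by simp

lemma L2_diff:
  fixes f g :: "'a \<Rightarrow> 'b::{real_normed_vector,second_countable_topology}"
  assumes "f \<in> L2 M" "g \<in> L2 M"
  shows "(\<lambda>x. f x - g x) \<in> L2 M"
  using L2_add[OF assms(1) L2_scaleR[OF assms(2), of "-1"]] by simp

lemma L2_zero: "(\<lambda>x. 0) \<in> L2 M"
  by (simp add: L2_def)

lemma L2_sum:
  fixes f :: "'i \<Rightarrow> 'a \<Rightarrow> 'b::{real_normed_vector,second_countable_topology}"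
  assumes "\<And>i. i \<in> I \<Longrightarrow> f i \<in> L2 M"
  shows "(\<lambda>x. \<Sum>i\<in>I. f i x) \<in> L2 M"
  using assms
proof (induction I rule: infinite_finite_induct)
  case (insert i I)
  then show ?case by (simp add: L2_add)
qed (simp_all add: L2_zero)

lemma L2_bounded:
  fixes f :: "'a \<Rightarrow> 'b::{real_normed_vector,second_countable_topology}"
  assumes "finite_measure M" and f: "f \<in> borel_measurable M" and b: "\<And>x. norm (f x) \<le> B"
  shows "f \<in> L2 M"
proof -
  interpret finite_measure M by fact
  have "integrable M (\<lambda>x. (norm (f x))\<^sup>2)"
    by (rule integrable_const_bound[of _ "B\<^sup>2"])
       (use f b norm_ge_zero in \<open>auto intro!: AE_I2 power_mono\<close>)
  with f show ?thesis by (simp add: L2_def)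
qed

lemma L2_mult_integrable:
  fixes f g :: "'a \<Rightarrow> real"
  assumes f: "f \<in> L2 M" and g: "g \<in> L2 M"
  shows "integrable M (\<lambda>x. f x * g x)"
proof -
  note [measurable] = L2_measurable[OF f] L2_measurable[OF g]
  have bound: "\<bar>a * b\<bar> \<le> a\<^sup>2 + b\<^sup>2" for a b :: real
  proof -
    have "2 * \<bar>a * b\<bar> \<le> a\<^sup>2 + b\<^sup>2"
      using sum_squares_bound[of "\<bar>a\<bar>" "\<bar>b\<bar>"] by (simp add: abs_mult mult.assoc)
    then show ?thesis using abs_ge_zero[of "a * b"] by linarith
  qed
  show ?thesis
  proof (rule Bochner_Integration.integrable_bound)
    show "integrable M (\<lambda>x. (norm (f x))\<^sup>2 + (norm (g x))\<^sup>2)"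
      by (intro Bochner_Integration.integrable_add L2_sq_integrable f g)
    show "AE x in M. norm (f x * g x) \<le> norm ((norm (f x))\<^sup>2 + (norm (g x))\<^sup>2)"
      using bound by simp
  qed measurable
qed

lemma L2_integrable:
  fixes f :: "'a \<Rightarrow> real"
  assumes "finite_measure M" and f: "f \<in> L2 M"
  shows "integrable M f"
  using L2_mult_integrable[OF f L2_bounded[of M "\<lambda>_. 1" 1]] assms(1) by auto

lemma L2_sqnorm_mult: "L2_sqnorm M f = (\<integral>x. f x * f x \<partial>M)" for f :: "'a \<Rightarrow> real"
  by (simp add: L2_sqnorm_def power2_eq_square)

lemma L2_sqnorm_add_scaled:
  fixes f g :: "'a \<Rightarrow> real"
  assumes f: "f \<in> L2 M" and g: "g \<in> L2 M"
  shows "L2_sqnorm M (\<lambda>x. f x + c * g x) =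
    L2_sqnorm M f + 2 * c * (\<integral>x. f x * g x \<partial>M) + c\<^sup>2 * L2_sqnorm M g"
proof -
  have "(f x + c * g x) * (f x + c * g x) = f x * f x + (2 * c) * (f x * g x) + c\<^sup>2 * (g x * g x)" for x
    by (simp add: algebra_simps power2_eq_square)
  then show ?thesis
    using L2_mult_integrable[OF f g] L2_mult_integrable[OF f f] L2_mult_integrable[OF g g]
    by (simp add: L2_sqnorm_mult)
qed

text \<open>
  The discriminant inequality. It serves twice: for the Cauchy-Schwarz inequality, and for
  near minimisers of a distance, where \<open>a\<close> is the excess over the infimum.
\<close>

lemma quadratic_nonneg_imp_sq_le:
  fixes a b d :: real
  assumes nonneg: "\<And>c. 0 \<le> a + 2 * c * b + c\<^sup>2 * d" and "0 \<le> d"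
  shows "b\<^sup>2 \<le> a * d"
proof (cases "d = 0")
  case True
  have "b = 0"
  proof (rule ccontr)
    assume "b \<noteq> 0"
    then show False using nonneg[of "- (a + 1) / (2 * b)"] True by (simp add: field_simps)
  qed
  then show ?thesis using True by simp
next
  case False
  with \<open>0 \<le> d\<close> have "d > 0" by simp
  then have "0 \<le> d * (a + 2 * (- b / d) * b + (- b / d)\<^sup>2 * d)"
    using nonneg by (metis less_imp_le mult_nonneg_nonneg)
  also have "\<dots> = a * d - b\<^sup>2"
    using \<open>d > 0\<close> by (simp add: field_simps power2_eq_square)
  finally show ?thesis by simp
qed

lemma L2_cauchy_schwarz:
  fixes f g :: "'a \<Rightarrow> real"
  assumes f: "f \<in> L2 M" and g: "g \<in> L2 M"
  shows "(\<integral>x. f x * g x \<partial>M)\<^sup>2 \<le> L2_sqnorm M f * L2_sqnorm M g"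
proof (rule quadratic_nonneg_imp_sq_le[OF _ L2_sqnorm_nonneg])
  fix c show "0 \<le> L2_sqnorm M f + 2 * c * (\<integral>x. f x * g x \<partial>M) + c\<^sup>2 * L2_sqnorm M g"
    unfolding L2_sqnorm_add_scaled[OF f g, symmetric] by (rule L2_sqnorm_nonneg)
qed

lemma L2_cauchy_schwarz_abs:
  fixes f g :: "'a \<Rightarrow> real"
  assumes f: "f \<in> L2 M" and g: "g \<in> L2 M"
  shows "\<bar>\<integral>x. f x * g x \<partial>M\<bar> \<le> sqrt (L2_sqnorm M f) * sqrt (L2_sqnorm M g)"
  using real_sqrt_le_mono[OF L2_cauchy_schwarz[OF f g]] by (simp add: real_sqrt_mult)

lemma L2_sqnorm_add_le:
  fixes f g :: "'a \<Rightarrow> 'b::{real_normed_vector,second_countable_topology}"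
  assumes f: "f \<in> L2 M" and g: "g \<in> L2 M"
  shows "L2_sqnorm M (\<lambda>x. f x + g x) \<le> 2 * L2_sqnorm M f + 2 * L2_sqnorm M g"
proof -
  have "L2_sqnorm M (\<lambda>x. f x + g x) \<le> (\<integral>x. 2 * (norm (f x))\<^sup>2 + 2 * (norm (g x))\<^sup>2 \<partial>M)"
    unfolding L2_sqnorm_def
    by (rule integral_mono)
       (use L2_sq_integrable[OF L2_add[OF f g]] L2_sq_integrable[OF f] L2_sq_integrable[OF g] norm_add_sq_le in auto)
  also have "\<dots> = 2 * L2_sqnorm M f + 2 * L2_sqnorm M g"
    using L2_sq_integrable[OF f] L2_sq_integrable[OF g] by (simp add: L2_sqnorm_def)
  finally show ?thesis .
qed

lemma L2_sqnorm_cmult: "L2_sqnorm M (\<lambda>x. c * f x) = c\<^sup>2 * L2_sqnorm M f" for f :: "'a \<Rightarrow> real"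
  by (simp add: L2_sqnorm_def power_mult_distrib)

text \<open>
  Joint continuity of the inner product. With \<open>gs = fs\<close> it gives convergence of norms, and with \<open>gs\<close> the
  constant sequence \<open>1\<close> on a probability space it gives convergence of means.
\<close>

lemma L2_inner_tendsto:
  fixes fs gs :: "nat \<Rightarrow> 'a \<Rightarrow> real"
  assumes fs: "\<And>k. fs k \<in> L2 M" and f: "f \<in> L2 M" and gs: "\<And>k. gs k \<in> L2 M" and g: "g \<in> L2 M"
    and fl: "(\<lambda>k. L2_sqnorm M (\<lambda>x. fs k x - f x)) \<longlonglongrightarrow> 0"
    and gl: "(\<lambda>k. L2_sqnorm M (\<lambda>x. gs k x - g x)) \<longlonglongrightarrow> 0"
  shows "(\<lambda>k. \<integral>x. fs k x * gs k x \<partial>M) \<longlonglongrightarrow> (\<integral>x. f x * g x \<partial>M)"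
proof (rule Lim_transform2[OF tendsto_const], rule tendsto_rabs_zero_cancel)
  let ?F = "\<lambda>k. sqrt (L2_sqnorm M (\<lambda>x. fs k x - f x))"
  let ?G = "\<lambda>k. sqrt (L2_sqnorm M (\<lambda>x. gs k x - g x))"
  let ?b = "\<lambda>k. ?F k * ?G k + sqrt (L2_sqnorm M f) * ?G k + ?F k * sqrt (L2_sqnorm M g)"
  have "?F \<longlonglongrightarrow> sqrt 0" "?G \<longlonglongrightarrow> sqrt 0"
    by (intro tendsto_real_sqrt fl gl)+
  then have FG: "?F \<longlonglongrightarrow> 0" "?G \<longlonglongrightarrow> 0" by simp_all
  have "?b \<longlonglongrightarrow> 0 * 0 + sqrt (L2_sqnorm M f) * 0 + 0 * sqrt (L2_sqnorm M g)"
    by (intro tendsto_intros FG)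
  then have b: "?b \<longlonglongrightarrow> 0" by simp
  have bound: "\<bar>(\<integral>x. f x * g x \<partial>M) - (\<integral>x. fs k x * gs k x \<partial>M)\<bar> \<le> ?b k" for k
  proof -
    note df = L2_diff[OF fs[of k] f] and dg = L2_diff[OF gs[of k] g]
    have "(\<integral>x. fs k x * gs k x \<partial>M) - (\<integral>x. f x * g x \<partial>M) =
      (\<integral>x. fs k x * gs k x - f x * g x \<partial>M)"
      by (intro Bochner_Integration.integral_diff[symmetric] L2_mult_integrable fs gs f g)
    also have "\<dots> = (\<integral>x. ((fs k x - f x) * (gs k x - g x) + f x * (gs k x - g x)) + (fs k x - f x) * g x \<partial>M)"
      by (simp add: algebra_simps)
    also have "\<dots> = (\<integral>x. (fs k x - f x) * (gs k x - g x) \<partial>M) + (\<integral>x. f x * (gs k x - g x) \<partial>M)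
        + (\<integral>x. (fs k x - f x) * g x \<partial>M)"
      using L2_mult_integrable[OF df dg] L2_mult_integrable[OF f dg] L2_mult_integrable[OF df g]
      by simp
    finally show ?thesis
      using L2_cauchy_schwarz_abs[OF df dg] L2_cauchy_schwarz_abs[OF f dg] L2_cauchy_schwarz_abs[OF df g]
      by linarith
  qed
  show "(\<lambda>k. \<bar>(\<integral>x. f x * g x \<partial>M) - (\<integral>x. fs k x * gs k x \<partial>M)\<bar>) \<longlonglongrightarrow> 0"
    by (rule tendsto_sandwich[OF _ _ tendsto_const b]) (use bound in auto)
qed

text \<open>
  The Riesz-Fischer argument: along a subsequence whose increments have summable \<open>L\<^sup>1\<close> norms the functions
  converge almost everywhere, and Fatou's lemma turns this into convergence of the whole sequence in \<open>L\<^sup>2\<close>.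
\<close>

lemma L2_complete:
  fixes fs :: "nat \<Rightarrow> 'a \<Rightarrow> real"
  assumes M: "finite_measure M" and fs: "\<And>k. fs k \<in> L2 M"
    and cauchy: "\<And>e. 0 < e \<Longrightarrow> \<exists>N. \<forall>m\<ge>N. \<forall>n\<ge>N. L2_sqnorm M (\<lambda>x. fs m x - fs n x) < e"
  shows "\<exists>f\<in>L2 M. (\<lambda>k. L2_sqnorm M (\<lambda>x. fs k x - f x)) \<longlonglongrightarrow> 0"
proof -
  interpret finite_measure M by fact
  note [measurable] = L2_measurable[OF fs]
  define d where "d m n = L2_sqnorm M (\<lambda>x. fs m x - fs n x)" for m n
  \<comment> \<open>Squared distances below \<open>(1/4)^k\<close> make the increments summable, since their \<open>L\<^sup>1\<close> norms are
     of order \<open>(1/2)^k\<close> on a finite measure space.\<close>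
  have "\<exists>r. \<forall>k. (\<forall>m\<ge>r k. \<forall>n\<ge>r k. d m n < (1/4)^k) \<and> r k < r (Suc k)"
  proof (rule dependent_nat_choice)
    show "\<exists>x. \<forall>m\<ge>x. \<forall>n\<ge>x. d m n < (1 / 4) ^ 0"
      using cauchy[of 1] by (simp add: d_def)
  next
    fix x k
    obtain N where "\<forall>m\<ge>N. \<forall>n\<ge>N. d m n < (1 / 4) ^ Suc k"
      using cauchy[of "(1/4)^Suc k"] by (auto simp: d_def)
    then show "\<exists>y. (\<forall>m\<ge>y. \<forall>n\<ge>y. d m n < (1 / 4) ^ Suc k) \<and> x < y"
      by (intro exI[of _ "max N (Suc x)"]) auto
  qed
  then obtain r where r: "\<And>k m n. r k \<le> m \<Longrightarrow> r k \<le> n \<Longrightarrow> d m n < (1/4)^k" and rS: "\<And>k. r k < r (Suc k)"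
    by blast
  have mono_r: "strict_mono r" by (simp add: strict_mono_Suc_iff rS)
  define g where "g k x = fs (r (Suc k)) x - fs (r k) x" for k x
  have gL: "g k \<in> L2 M" for k unfolding g_def by (intro L2_diff fs)
  note [measurable] = L2_measurable[OF gL]
  have one: "(\<lambda>x. 1::real) \<in> L2 M" by (rule L2_bounded[OF M, of _ 1]) auto
  define c where "c = sqrt (L2_sqnorm M (\<lambda>x. 1::real))"
  have g_int: "(\<integral>\<^sup>+x. ennreal \<bar>g k x\<bar> \<partial>M) \<le> ennreal ((1/2)^k * c)" for k
  proof -
    have abs: "(\<lambda>x. \<bar>g k x\<bar>) \<in> L2 M" using gL[of k] by (auto simp: L2_def)
    have "L2_sqnorm M (\<lambda>x. \<bar>g k x\<bar>) = d (r (Suc k)) (r k)"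
      by (simp add: L2_sqnorm_def d_def g_def)
    also have "\<dots> \<le> (1/4)^k" using r[of k "r (Suc k)" "r k"] rS[of k] by simp
    finally have "sqrt (L2_sqnorm M (\<lambda>x. \<bar>g k x\<bar>)) \<le> sqrt ((1/4)^k)" by simp
    also have "\<dots> = (1/2)^k" by (simp add: real_sqrt_power real_sqrt_divide)
    finally have "sqrt (L2_sqnorm M (\<lambda>x. \<bar>g k x\<bar>)) * c \<le> (1/2)^k * c"
      by (intro mult_right_mono) (simp_all add: c_def L2_sqnorm_nonneg)
    then have "(\<integral>x. \<bar>g k x\<bar> \<partial>M) \<le> (1/2)^k * c"
      using L2_cauchy_schwarz_abs[OF abs one] by (simp add: c_def)
    moreover have "(\<integral>\<^sup>+x. ennreal \<bar>g k x\<bar> \<partial>M) = ennreal (\<integral>x. \<bar>g k x\<bar> \<partial>M)"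
      by (rule nn_integral_eq_integral) (use L2_integrable[OF M gL[of k]] in auto)
    ultimately show ?thesis by (simp add: ennreal_leI)
  qed
  have "(\<integral>\<^sup>+x. (\<Sum>k. ennreal \<bar>g k x\<bar>) \<partial>M) = (\<Sum>k. \<integral>\<^sup>+x. ennreal \<bar>g k x\<bar> \<partial>M)"
    by (rule nn_integral_suminf) auto
  also have "\<dots> \<le> (\<Sum>k. ennreal ((1/2)^k * c))"
    by (intro suminf_le g_int) auto
  also have "\<dots> = ennreal (\<Sum>k. (1/2)^k * c)"
    by (rule suminf_ennreal2)
       (auto simp: c_def L2_sqnorm_nonneg intro!: summable_mult2 summable_geometric)
  finally have "(\<integral>\<^sup>+x. (\<Sum>k. ennreal \<bar>g k x\<bar>) \<partial>M) \<noteq> \<infinity>"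
    by (auto simp: top_unique)
  then have "AE x in M. (\<Sum>k. ennreal \<bar>g k x\<bar>) \<noteq> \<infinity>"
    by (intro nn_integral_PInf_AE) auto
  then have conv: "AE x in M. (\<lambda>k. fs (r k) x) \<longlonglongrightarrow> lim (\<lambda>k. fs (r k) x)"
  proof eventually_elim
    case (elim x)
    then have "summable (\<lambda>k. \<bar>g k x\<bar>)"
      by (intro summable_suminf_not_top) auto
    then have "summable (\<lambda>k. g k x)" by (rule summable_rabs_cancel)
    then have "convergent (\<lambda>n. fs (r 0) x + (\<Sum>k<n. g k x))"
      by (intro convergent_add convergent_const) (simp add: summable_iff_convergent)
    moreover have "(\<Sum>k<n. g k x) = fs (r n) x - fs (r 0) x" for n
      unfolding g_def by (rule sum_lessThan_telescope)
    ultimately show ?case by (simp add: convergent_LIMSEQ_iff)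
  qed
  define f where "f x = lim (\<lambda>k. fs (r k) x)" for x
  have [measurable]: "f \<in> borel_measurable M"
    unfolding f_def by (rule borel_measurable_lim_metric) simp
  have fatou: "(\<integral>\<^sup>+x. ennreal ((fs m x - f x)\<^sup>2) \<partial>M) \<le> ennreal ((1/4)^j)" if "r j \<le> m" for m j
  proof -
    have "(\<integral>\<^sup>+x. ennreal ((fs m x - f x)\<^sup>2) \<partial>M) =
      (\<integral>\<^sup>+x. liminf (\<lambda>k. ennreal ((fs m x - fs (r k) x)\<^sup>2)) \<partial>M)"
    proof (rule nn_integral_cong_AE, use conv in eventually_elim)
      case (elim x)
      then have "(\<lambda>k. ennreal ((fs m x - fs (r k) x)\<^sup>2)) \<longlonglongrightarrow> ennreal ((fs m x - f x)\<^sup>2)"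
        unfolding f_def by (intro tendsto_intros)
      then show ?case by (intro lim_imp_Liminf[symmetric]) auto
    qed
    also have "\<dots> \<le> liminf (\<lambda>k. \<integral>\<^sup>+x. ennreal ((fs m x - fs (r k) x)\<^sup>2) \<partial>M)"
      by (rule nn_integral_liminf) simp
    also have "\<dots> \<le> liminf (\<lambda>k. ennreal ((1/4)^j))"
    proof (rule Liminf_mono, rule eventually_sequentiallyI[of j])
      fix k assume "j \<le> k"
      then have rk: "r j \<le> r k" using mono_r by (simp add: strict_mono_less_eq)
      have "(\<integral>\<^sup>+x. ennreal ((fs m x - fs (r k) x)\<^sup>2) \<partial>M) = ennreal (d m (r k))"
        unfolding d_def L2_sqnorm_def
        using L2_sq_integrable[OF L2_diff[OF fs[of m] fs[of "r k"]]]
        by (subst nn_integral_eq_integral) auto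
      also have "\<dots> \<le> ennreal ((1/4)^j)"
        using r[OF that rk] by (intro ennreal_leI) simp
      finally show "(\<integral>\<^sup>+x. ennreal ((fs m x - fs (r k) x)\<^sup>2) \<partial>M) \<le> ennreal ((1/4)^j)" .
    qed
    also have "\<dots> = ennreal ((1/4)^j)" by (simp add: Liminf_const)
    finally show ?thesis .
  qed
  have diff: "(\<lambda>x. fs m x - f x) \<in> L2 M" if "r 0 \<le> m" for m
  proof -
    have "integrable M (\<lambda>x. (fs m x - f x)\<^sup>2)"
      by (rule integrableI_bounded) (use fatou[OF that] in \<open>auto simp: le_less_trans\<close>)
    then show ?thesis by (simp add: L2_def)
  qed
  have "f \<in> L2 M" using L2_diff[OF fs[of "r 0"] diff[of "r 0"]] by simp
  moreover have "(\<lambda>k. L2_sqnorm M (\<lambda>x. fs k x - f x)) \<longlonglongrightarrow> 0"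
  proof (rule LIMSEQ_I)
    fix e :: real assume "0 < e"
    then obtain j where j: "(1/4)^j < e" using real_arch_pow_inv[of e "1/4"] by auto
    have "norm (L2_sqnorm M (\<lambda>x. fs m x - f x) - 0) < e" if "r j \<le> m" for m
    proof -
      have "ennreal (L2_sqnorm M (\<lambda>x. fs m x - f x)) = (\<integral>\<^sup>+x. ennreal ((fs m x - f x)\<^sup>2) \<partial>M)"
        unfolding L2_sqnorm_def
        using L2_sq_integrable[OF L2_diff[OF fs[of m] \<open>f \<in> L2 M\<close>]]
        by (subst nn_integral_eq_integral) auto
      also have "\<dots> \<le> ennreal ((1/4)^j)" by (rule fatou[OF that])
      finally have "L2_sqnorm M (\<lambda>x. fs m x - f x) \<le> (1/4)^j" by simp
      with j show ?thesis using L2_sqnorm_nonneg[of M "\<lambda>x. fs m x - f x"] by simp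
    qed
    then show "\<exists>no. \<forall>n\<ge>no. norm (L2_sqnorm M (\<lambda>x. fs n x - f x) - 0) < e" by blast
  qed
  ultimately show ?thesis by blast
qed

section \<open>Characteristic functions and independence\<close>

text \<open>
  Since \<open>\<bar>W\<bar> \<le> 1\<close>, the function \<open>1 + W\<close> is the density of another probability measure (its mass is seen by taking
  \<open>s = 0\<close>). Under both measures \<open>R\<close> has the same characteristic function, hence by Levy's theorem the same law,
  and the difference of the two laws is integration against \<open>W\<close>.
\<close>

lemma (in prob_space) weight_vanishes_on_events:
  fixes W R :: "'a \<Rightarrow> real"
  assumes W [measurable]: "W \<in> borel_measurable M" and W_le: "\<And>x. \<bar>W x\<bar> \<le> 1"
    and R [measurable]: "R \<in> borel_measurable M"
    and vanish: "\<And>s. (\<integral>x. complex_of_real (W x) * iexp (s * R x) \<partial>M) = 0"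
    and A [measurable]: "A \<in> sets borel"
  shows "(\<integral>x. W x * indicator A (R x) \<partial>M) = 0"
proof -
  define N where "N = density M (\<lambda>x. ennreal (1 + W x))"
  have nn: "0 \<le> 1 + W x" for x using W_le[of x] by linarith
  have W_int: "integrable M W"
    by (rule integrable_const_bound[of _ 1]) (use W_le in auto)
  have "complex_of_real (\<integral>x. W x \<partial>M) = 0"
    using vanish[of 0] by simp
  then have W0: "(\<integral>x. W x \<partial>M) = 0" by simp
  have setsN [measurable_cong, simp]: "sets N = sets M" by (simp add: N_def)
  have "emeasure N (space N) = (\<integral>\<^sup>+x. ennreal (1 + W x) \<partial>M)"
    unfolding N_def by (simp add: emeasure_density cong: nn_integral_cong)
  also have "\<dots> = ennreal (\<integral>x. 1 + W x \<partial>M)"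
    by (rule nn_integral_eq_integral) (use W_int nn in auto)
  also have "\<dots> = 1" using W_int W0 by (simp add: prob_space)
  finally interpret N: prob_space N by (rule prob_spaceI)
  have eq: "distr N borel R = distr M borel R"
  proof (rule Levy_uniqueness)
    show "real_distribution (distr N borel R)" by (rule N.real_distribution_distr) simp
    show "real_distribution (distr M borel R)" by (rule real_distribution_distr) simp
    show "char (distr N borel R) = char (distr M borel R)"
    proof
      fix t
      have i1: "integrable M (\<lambda>x. iexp (t * R x))"
        by (rule integrable_const_bound[of _ 1]) auto
      have i2: "integrable M (\<lambda>x. complex_of_real (W x) * iexp (t * R x))"
        by (rule integrable_const_bound[of _ 1]) (use W_le in \<open>auto simp: norm_mult\<close>)
      have "char (distr N borel R) t = (\<integral>x. iexp (t * R x) \<partial>N)"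
        unfolding char_def by (rule integral_distr) auto
      also have "\<dots> = (\<integral>x. (1 + W x) *\<^sub>R iexp (t * R x) \<partial>M)"
        unfolding N_def by (rule integral_density) (use nn in auto)
      also have "\<dots> = (\<integral>x. iexp (t * R x) + complex_of_real (W x) * iexp (t * R x) \<partial>M)"
        by (simp add: scaleR_conv_of_real algebra_simps)
      also have "\<dots> = (\<integral>x. iexp (t * R x) \<partial>M)"
        using vanish[of t] i1 i2 by simp
      also have "\<dots> = char (distr M borel R) t"
        unfolding char_def by (rule integral_distr[symmetric]) auto
      finally show "char (distr N borel R) t = char (distr M borel R) t" .
    qed
  qed
  have ind: "integrable M (\<lambda>x. indicator A (R x) :: real)"
    by (rule integrable_const_bound[of _ 1]) (auto simp: indicator_def)
  have indW: "integrable M (\<lambda>x. W x * indicator A (R x))"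
    by (rule integrable_const_bound[of _ 1]) (use W_le in \<open>auto simp: indicator_def\<close>)
  have "(\<integral>x. indicator A (R x) + W x * indicator A (R x) \<partial>M) = (\<integral>x. (1 + W x) *\<^sub>R (indicator A (R x) :: real) \<partial>M)"
    by (simp add: algebra_simps)
  also have "\<dots> = (\<integral>x. indicator A (R x) \<partial>N)"
    unfolding N_def by (rule integral_density[symmetric]) (use nn in auto)
  also have "\<dots> = (\<integral>y. indicator A y \<partial>distr N borel R)"
    by (rule integral_distr[symmetric]) auto
  also have "\<dots> = (\<integral>x. indicator A (R x) \<partial>M)"
    unfolding eq by (rule integral_distr) auto
  finally show ?thesis using ind indW by simp
qed

text \<open>
  Conjugation turns \<open>s\<close> into \<open>- s\<close>, so the hypothesis passes to the conjugate weight and from there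
  to the real and imaginary parts. Complex weights are what makes an induction over coordinates possible:
  the exponential of the remaining coordinates can be absorbed into the weight.
\<close>

lemma (in prob_space) complex_weight_vanishes_on_events:
  fixes W :: "'a \<Rightarrow> complex" and R :: "'a \<Rightarrow> real"
  assumes W [measurable]: "W \<in> borel_measurable M" and W_le: "\<And>x. norm (W x) \<le> 1"
    and R [measurable]: "R \<in> borel_measurable M"
    and vanish: "\<And>s. (\<integral>x. W x * iexp (s * R x) \<partial>M) = 0"
    and A [measurable]: "A \<in> sets borel"
  shows "(\<integral>x. W x * indicator A (R x) \<partial>M) = 0"
proof -
  have int: "integrable M (\<lambda>x. V x * E x)"
    if [measurable]: "V \<in> borel_measurable M" "E \<in> borel_measurable M"
      and "\<And>x. norm (V x) \<le> 1" "\<And>x. norm (E x) \<le> 1" for V E :: "'a \<Rightarrow> complex"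
    by (rule integrable_const_bound[of _ 1]) (use that(3,4) in \<open>auto simp: norm_mult intro!: mult_le_one\<close>)
  have [measurable]: "(\<lambda>x. cnj (W x)) \<in> borel_measurable M"
    by (rule measurable_compose[OF W borel_measurable_continuous_onI]) (intro continuous_intros)
  have cnj_vanish: "(\<integral>x. cnj (W x) * iexp (s * R x) \<partial>M) = 0" for s
  proof -
    have "(\<integral>x. cnj (W x) * iexp (s * R x) \<partial>M) = (\<integral>x. cnj (W x * iexp ((- s) * R x)) \<partial>M)"
      by (simp add: exp_cnj)
    also have "\<dots> = cnj (\<integral>x. W x * iexp ((- s) * R x) \<partial>M)"
      by (rule Bochner_Integration.integral_cnj)
    finally show ?thesis unfolding vanish by simp
  qed
  have "(\<integral>x. complex_of_real (Re (W x)) * iexp (s * R x) \<partial>M) = 0" for s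
  proof -
    have "(\<integral>x. complex_of_real (Re (W x)) * iexp (s * R x) \<partial>M)
        = (\<integral>x. (1/2) * (W x * iexp (s * R x) + cnj (W x) * iexp (s * R x)) \<partial>M)"
      by (intro Bochner_Integration.integral_cong refl)
         (simp add: complex_eq_iff field_simps)
    also have "\<dots> = (1/2) * ((\<integral>x. W x * iexp (s * R x) \<partial>M) + (\<integral>x. cnj (W x) * iexp (s * R x) \<partial>M))"
      by (subst integral_mult_right_zero, subst Bochner_Integration.integral_add)
         (auto intro!: int W_le simp: W_le)
    finally show ?thesis unfolding vanish cnj_vanish by simp
  qed
  then have re: "(\<integral>x. Re (W x) * indicator A (R x) \<partial>M) = 0"
    by (intro weight_vanishes_on_events) (auto intro: order_trans[OF abs_Re_le_cmod W_le])
  have "(\<integral>x. complex_of_real (Im (W x)) * iexp (s * R x) \<partial>M) = 0" for s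
  proof -
    have "(\<integral>x. complex_of_real (Im (W x)) * iexp (s * R x) \<partial>M)
        = (\<integral>x. (- \<i>/2) * (W x * iexp (s * R x) - cnj (W x) * iexp (s * R x)) \<partial>M)"
      by (intro Bochner_Integration.integral_cong refl)
         (simp add: complex_eq_iff field_simps)
    also have "\<dots> = (- \<i>/2) * ((\<integral>x. W x * iexp (s * R x) \<partial>M) - (\<integral>x. cnj (W x) * iexp (s * R x) \<partial>M))"
      by (subst integral_mult_right_zero, subst Bochner_Integration.integral_diff)
         (auto intro!: int W_le simp: W_le)
    finally show ?thesis unfolding vanish cnj_vanish by simp
  qed
  then have im: "(\<integral>x. Im (W x) * indicator A (R x) \<partial>M) = 0"
    by (intro weight_vanishes_on_events) (auto intro: order_trans[OF abs_Im_le_cmod W_le])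
  have [measurable]: "(\<lambda>x. indicator A (R x) :: complex) \<in> borel_measurable M" by measurable
  have i: "integrable M (\<lambda>x. W x * indicator A (R x))"
    by (rule int) (use W_le in \<open>auto simp: indicator_def\<close>)
  show ?thesis
  proof (rule complex_eqI)
    have "Re (\<integral>x. W x * indicator A (R x) \<partial>M) = (\<integral>x. Re (W x * indicator A (R x)) \<partial>M)"
      by (rule integral_Re[OF i, symmetric])
    also have "\<dots> = (\<integral>x. Re (W x) * indicator A (R x) \<partial>M)"
      by (intro Bochner_Integration.integral_cong refl) (simp add: indicator_def)
    finally show "Re (\<integral>x. W x * indicator A (R x) \<partial>M) = Re 0" using re by simp
    have "Im (\<integral>x. W x * indicator A (R x) \<partial>M) = (\<integral>x. Im (W x * indicator A (R x)) \<partial>M)"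
      by (rule integral_Im[OF i, symmetric])
    also have "\<dots> = (\<integral>x. Im (W x) * indicator A (R x) \<partial>M)"
      by (intro Bochner_Integration.integral_cong refl) (simp add: indicator_def)
    finally show "Im (\<integral>x. W x * indicator A (R x) \<partial>M) = Im 0" using im by simp
  qed
qed

text \<open>
  Uniqueness of characteristic functions in several variables, by treating the coordinates one after the other:
  for fixed frequencies of the other coordinates, the one-dimensional result replaces the exponential
  in coordinate \<open>j\<close> by an indicator function, which then becomes part of the weight.
\<close>

lemma (in prob_space) complex_weight_vanishes_on_boxes:
  fixes W :: "'a \<Rightarrow> complex" and R :: "'i \<Rightarrow> 'a \<Rightarrow> real"
  assumes "finite K"
    and W: "W \<in> borel_measurable M" "\<And>x. norm (W x) \<le> 1"
    and R: "\<And>i. R i \<in> borel_measurable M"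
    and vanish: "\<And>\<xi>. (\<integral>x. W x * iexp (\<Sum>i\<in>K. \<xi> i * R i x) \<partial>M) = 0"
    and A: "\<And>i. A i \<in> sets borel"
  shows "(\<integral>x. W x * (\<Prod>i\<in>K. indicator (A i) (R i x)) \<partial>M) = 0"
  using \<open>finite K\<close> W vanish
proof (induction K arbitrary: W)
  case empty
  then show ?case by simp
next
  case (insert j K)
  note [measurable] = R A insert.prems(1)
  define W' where "W' x = W x * indicator (A j) (R j x)" for x
  have m [measurable]: "W' \<in> borel_measurable M" unfolding W'_def by measurable
  have le: "norm (W' x) \<le> 1" for x
    using insert.prems(2)[of x] by (auto simp: W'_def indicator_def)
  have "(\<integral>x. W' x * iexp (\<Sum>i\<in>K. \<xi> i * R i x) \<partial>M) = 0" for \<xi>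
  proof -
    define V where "V x = W x * iexp (\<Sum>i\<in>K. \<xi> i * R i x)" for x
    have [measurable]: "V \<in> borel_measurable M" unfolding V_def by measurable
    have "(\<integral>x. V x * iexp (s * R j x) \<partial>M) = 0" for s
    proof -
      have s: "(\<Sum>i\<in>insert j K. (\<xi>(j := s)) i * R i x) = s * R j x + (\<Sum>i\<in>K. \<xi> i * R i x)" for x
      proof -
        have "(\<Sum>i\<in>K. (\<xi>(j := s)) i * R i x) = (\<Sum>i\<in>K. \<xi> i * R i x)"
          by (rule sum.cong) (use insert.hyps in auto)
        then show ?thesis using insert.hyps by simp
      qed
      have "V x * iexp (s * R j x) = W x * iexp (\<Sum>i\<in>insert j K. (\<xi>(j := s)) i * R i x)" for x
        unfolding V_def s by (simp add: exp_add[symmetric] algebra_simps)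
      then show ?thesis using insert.prems(3)[of "\<xi>(j := s)"] by simp
    qed
    then have "(\<integral>x. V x * indicator (A j) (R j x) \<partial>M) = 0"
      by (intro complex_weight_vanishes_on_events)
         (use insert.prems(2) in \<open>auto simp: V_def norm_mult\<close>)
    moreover have "V x * indicator (A j) (R j x) = W' x * iexp (\<Sum>i\<in>K. \<xi> i * R i x)" for x
      by (simp add: V_def W'_def)
    ultimately show ?thesis by simp
  qed
  from insert.IH[OF m le this]
  show ?case using insert.hyps by (simp add: W'_def mult.assoc)
qed

lemma nn_integral_indicator_comp:
  assumes [measurable]: "f \<in> measurable M N" "E \<in> sets N"
  shows "(\<integral>\<^sup>+x. ennreal (indicator E (f x)) \<partial>M) = emeasure (distr M N f) E"
proof -
  have "emeasure (distr M N f) E = (\<integral>\<^sup>+y. indicator E y \<partial>distr M N f)" by simp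
  also have "\<dots> = (\<integral>\<^sup>+x. indicator E (f x) \<partial>M)" by (rule nn_integral_distr) simp_all
  finally show ?thesis by (simp add: ennreal_indicator)
qed

text \<open>
  If the joint characteristic function factorises, then \<open>U\<close> and the whole sequence \<open>R\<close> are independent, whatever the dependence
  among the \<open>R i\<close>. The vanishing lemmas are used with two weights: first with
  \<open>exp (\<i> s U) - E[exp (\<i> s U)]\<close> to replace the exponentials in \<open>R\<close> by the indicator of a box, then with this
  indicator minus its mean to replace the exponential in \<open>U\<close> by an indicator.
\<close>

lemma (in prob_space) joint_law_eq_product:
  fixes U :: "'a \<Rightarrow> real" and R :: "nat \<Rightarrow> 'a \<Rightarrow> real"
  assumes U [measurable]: "U \<in> borel_measurable M"
    and R [measurable]: "\<And>i. R i \<in> borel_measurable M"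
    and factor: "\<And>s \<xi> K. finite K \<Longrightarrow>
      (\<integral>x. iexp (s * U x) * iexp (\<Sum>i\<in>K. \<xi> i * R i x) \<partial>M) =
      (\<integral>x. iexp (s * U x) \<partial>M) * (\<integral>x. iexp (\<Sum>i\<in>K. \<xi> i * R i x) \<partial>M)"
  defines "S \<equiv> PiM (UNIV :: nat set) (\<lambda>_. borel :: real measure)"
  shows "distr M borel U \<Otimes>\<^sub>M distr M S (\<lambda>x i. R i x) =
    distr M (borel \<Otimes>\<^sub>M S) (\<lambda>x. (U x, \<lambda>i. R i x))"
proof -
  have RS [measurable]: "(\<lambda>x i. R i x) \<in> measurable M S"
    unfolding S_def by (rule measurable_PiM_single') auto
  have box: "(\<integral>x. indicator A (U x) * (\<Prod>i\<in>K. indicator (B i) (R i x)) \<partial>M) =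
      (\<integral>x. indicator A (U x) \<partial>M) * (\<integral>x. (\<Prod>i\<in>K. indicator (B i) (R i x)) \<partial>M :: real)"
    if K: "finite K" and A [measurable]: "A \<in> sets borel" and B [measurable]: "\<And>i. B i \<in> sets borel"
    for A B K
  proof -
    define I :: "'a \<Rightarrow> real" where "I x = (\<Prod>i\<in>K. indicator (B i) (R i x))" for x
    have I_m [measurable]: "I \<in> borel_measurable M" unfolding I_def by measurable
    have I01: "0 \<le> I x" "I x \<le> 1" for x
      unfolding I_def by (auto intro!: prod_nonneg prod_le_1 simp: indicator_def)
    define q where "q = (\<integral>x. I x \<partial>M)"
    have I_int: "integrable M I"
      by (rule integrable_const_bound[of _ 1]) (use I01 in auto)
    have q: "0 \<le> q" "q \<le> 1"
      unfolding q_def using I01 I_int by (auto intro: integral_nonneg integral_le_const)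
    have chr: "(\<integral>x. iexp (s * U x) * I x \<partial>M) = (\<integral>x. iexp (s * U x) \<partial>M) * q" for s
    proof -
      define c where "c = (\<integral>x. iexp (s * U x) \<partial>M)"
      have iU: "integrable M (\<lambda>x. iexp (s * U x))"
        by (rule integrable_const_bound[of _ 1]) auto
      have iUI: "integrable M (\<lambda>x. iexp (s * U x) * I x)"
        by (rule integrable_const_bound[of _ 1]) (use I01 in \<open>auto simp: norm_mult\<close>)
      have "norm c \<le> (\<integral>x. norm (iexp (s * U x)) \<partial>M)"
        unfolding c_def by (rule integral_norm_bound)
      then have c: "norm c \<le> 1" by (simp add: prob_space)
      \<comment> \<open>Division by \<open>2\<close> brings the weight into the unit disc.\<close>
      define W where "W x = (iexp (s * U x) - c) / 2" for x
      have "(\<integral>x. W x * (\<Prod>i\<in>K. indicator (B i) (R i x)) \<partial>M) = 0"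
      proof (rule complex_weight_vanishes_on_boxes[OF K])
        show "W \<in> borel_measurable M" unfolding W_def by measurable
        show "norm (W x) \<le> 1" for x
          using norm_triangle_ineq4[of "iexp (s * U x)" c] c by (simp add: W_def)
        show "(\<integral>x. W x * iexp (\<Sum>i\<in>K. \<xi> i * R i x) \<partial>M) = 0" for \<xi>
        proof -
          have i1: "integrable M (\<lambda>x. iexp (\<Sum>i\<in>K. \<xi> i * R i x))"
            by (rule integrable_const_bound[of _ 1]) (auto simp del: of_real_sum)
          have i2: "integrable M (\<lambda>x. iexp (s * U x) * iexp (\<Sum>i\<in>K. \<xi> i * R i x))"
            by (rule integrable_const_bound[of _ 1]) (auto simp: norm_mult simp del: of_real_sum)
          have "W x * iexp (\<Sum>i\<in>K. \<xi> i * R i x) =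
            (1/2) * (iexp (s * U x) * iexp (\<Sum>i\<in>K. \<xi> i * R i x) - c * iexp (\<Sum>i\<in>K. \<xi> i * R i x))" for x
            by (simp add: W_def field_simps del: of_real_sum)
          then have "(\<integral>x. W x * iexp (\<Sum>i\<in>K. \<xi> i * R i x) \<partial>M) =
            (\<integral>x. (1/2) * (iexp (s * U x) * iexp (\<Sum>i\<in>K. \<xi> i * R i x) - c * iexp (\<Sum>i\<in>K. \<xi> i * R i x)) \<partial>M)"
            by (intro Bochner_Integration.integral_cong refl)
          also have "\<dots> = (1/2) * ((\<integral>x. iexp (s * U x) * iexp (\<Sum>i\<in>K. \<xi> i * R i x) \<partial>M)
              - c * (\<integral>x. iexp (\<Sum>i\<in>K. \<xi> i * R i x) \<partial>M))"
            by (simp only: integral_mult_right_zero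
                Bochner_Integration.integral_diff[OF i2 integrable_mult_right[OF i1]])
          finally have "(\<integral>x. W x * iexp (\<Sum>i\<in>K. \<xi> i * R i x) \<partial>M) =
            (1/2) * ((\<integral>x. iexp (s * U x) * iexp (\<Sum>i\<in>K. \<xi> i * R i x) \<partial>M)
              - c * (\<integral>x. iexp (\<Sum>i\<in>K. \<xi> i * R i x) \<partial>M))" .
          then show ?thesis unfolding factor[OF K] c_def by simp
        qed
      qed (use B in auto)
      moreover have "W x * (\<Prod>i\<in>K. indicator (B i) (R i x)) = (1/2) * (iexp (s * U x) * I x - c * I x)" for x
      proof -
        have "complex_of_real (I x) = (\<Prod>i\<in>K. indicator (B i) (R i x))"
          unfolding I_def of_real_prod by (intro prod.cong) (auto simp: indicator_def)
        then show ?thesis by (simp add: W_def field_simps)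
      qed
      ultimately have "(\<integral>x. iexp (s * U x) * I x \<partial>M) - c * (\<integral>x. complex_of_real (I x) \<partial>M) = 0"
        using iUI I_int by simp
      then show ?thesis by (simp add: c_def q_def)
    qed
    have "(\<integral>x. (I x - q) * indicator A (U x) \<partial>M) = 0"
    proof (rule weight_vanishes_on_events)
      show "\<bar>I x - q\<bar> \<le> 1" for x using I01[of x] q by linarith
      show "(\<integral>x. complex_of_real (I x - q) * iexp (s * U x) \<partial>M) = 0" for s
      proof -
        have "integrable M (\<lambda>x. iexp (s * U x))"
          by (rule integrable_const_bound[of _ 1]) auto
        moreover have "integrable M (\<lambda>x. iexp (s * U x) * I x)"
          by (rule integrable_const_bound[of _ 1]) (use I01 in \<open>auto simp: norm_mult\<close>)
        moreover have "complex_of_real (I x - q) * iexp (s * U x) = iexp (s * U x) * I x - q * iexp (s * U x)" for x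
          by (simp add: algebra_simps)
        ultimately show ?thesis using chr[of s] by simp
      qed
    qed auto
    moreover have "integrable M (\<lambda>x. indicator A (U x) * I x)"
      by (rule integrable_const_bound[of _ 1]) (use I01 in \<open>auto simp: indicator_def\<close>)
    moreover have "integrable M (\<lambda>x. indicator A (U x) :: real)"
      by (rule integrable_const_bound[of _ 1]) (auto simp: indicator_def)
    moreover have "(I x - q) * indicator A (U x) = indicator A (U x) * I x - q * indicator A (U x)" for x
      by (simp add: algebra_simps)
    ultimately show ?thesis by (simp add: I_def q_def)
  qed
  interpret dU: prob_space "distr M borel U" by (rule prob_space_distr) simp
  interpret dR: prob_space "distr M S (\<lambda>x i. R i x)" by (rule prob_space_distr) simp
  show ?thesis
  proof (rule pair_measure_eqI)
    show "sigma_finite_measure (distr M borel U)" "sigma_finite_measure (distr M S (\<lambda>x i. R i x))"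
      by unfold_locales
    show "sets (distr M borel U \<Otimes>\<^sub>M distr M S (\<lambda>x i. R i x)) =
        sets (distr M (borel \<Otimes>\<^sub>M S) (\<lambda>x. (U x, \<lambda>i. R i x)))"
      by (simp cong: sets_pair_measure_cong)
    fix A B assume "A \<in> sets (distr M borel U)" "B \<in> sets (distr M S (\<lambda>x i. R i x))"
    then have A [measurable]: "A \<in> sets borel" and B [measurable]: "B \<in> sets S" by auto
    \<comment> \<open>For fixed \<open>A\<close>, both sides are finite measures in \<open>B\<close>, so that boxes suffice.\<close>
    define N where "N = density M (\<lambda>x. indicator A (U x))"
    define a where "a = emeasure (distr M borel U) A"
    have [measurable_cong, simp]: "sets N = sets M" by (simp add: N_def)
    have N_em: "emeasure N E = (\<integral>\<^sup>+x. indicator A (U x) * indicator E x \<partial>M)" if "E \<in> sets M" for E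
      unfolding N_def using that by (simp add: emeasure_density)
    have N_distr: "emeasure (distr N S (\<lambda>x i. R i x)) E =
        (\<integral>\<^sup>+x. indicator A (U x) * indicator E (\<lambda>i. R i x) \<partial>M)" if [measurable]: "E \<in> sets S" for E
    proof -
      have "emeasure (distr N S (\<lambda>x i. R i x)) E = emeasure N ((\<lambda>x i. R i x) -` E \<inter> space M)"
        by (subst emeasure_distr) (simp_all add: N_def)
      also have "\<dots> = (\<integral>\<^sup>+x. indicator A (U x) * indicator ((\<lambda>x i. R i x) -` E \<inter> space M) x \<partial>M)"
        by (rule N_em) measurable
      also have "\<dots> = (\<integral>\<^sup>+x. indicator A (U x) * indicator E (\<lambda>i. R i x) \<partial>M)"
        by (rule nn_integral_cong) (auto split: split_indicator)
      finally show ?thesis .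
    qed
    have "distr N S (\<lambda>x i. R i x) = density (distr M S (\<lambda>x i. R i x)) (\<lambda>_. a)"
    proof (rule measure_eqI_PiM_infinite[of _ "UNIV :: nat set" "\<lambda>_. borel :: real measure"])
      show "finite_measure (distr N S (\<lambda>x i. R i x))"
      proof (rule finite_measure.finite_measure_distr)
        have "emeasure N (space M) \<le> (\<integral>\<^sup>+x. 1 \<partial>M)"
          unfolding N_em[OF sets.top] by (rule nn_integral_mono) (auto simp: indicator_def)
        then show "finite_measure N"
          by (intro finite_measureI) (auto simp: N_def emeasure_space_1 top_unique)
        show "(\<lambda>x i. R i x) \<in> measurable N S" by simp
      qed
      fix D :: "nat \<Rightarrow> real set" and J :: "nat set"
      assume J: "finite J" and "\<And>i. i \<in> J \<Longrightarrow> D i \<in> sets borel"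
      define D' where "D' i = (if i \<in> J then D i else UNIV)" for i
      have D' [measurable]: "D' i \<in> sets borel" for i
        using \<open>\<And>i. i \<in> J \<Longrightarrow> D i \<in> sets borel\<close> by (simp add: D'_def)
      define E where "E = prod_emb UNIV (\<lambda>_. borel :: real measure) J (Pi\<^sub>E J D)"
      have E_eq: "E = {f. \<forall>i\<in>J. f i \<in> D i}"
        by (auto simp: E_def prod_emb_def PiE_iff space_PiM)
      have E [measurable]: "E \<in> sets S"
        unfolding E_def S_def
        by (intro sets_PiM_I) (use J \<open>\<And>i. i \<in> J \<Longrightarrow> D i \<in> sets borel\<close> in auto)
      have ind: "indicator E (\<lambda>i. R i x) = (\<Prod>i\<in>J. indicator (D' i) (R i x) :: real)" for x
        using J by (auto simp: E_eq D'_def indicator_def prod_zero_iff)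
      have prE [measurable]: "(\<lambda>x i. R i x) -` E \<inter> space M \<in> sets M" by measurable
      have en: "ennreal (\<integral>x. I x \<partial>M) = (\<integral>\<^sup>+x. ennreal (I x) \<partial>M)"
        if "I \<in> borel_measurable M" "\<And>x. 0 \<le> I x" "\<And>x. I x \<le> 1" for I :: "'a \<Rightarrow> real"
      proof (rule nn_integral_eq_integral[symmetric])
        show "integrable M I" by (rule integrable_const_bound[of _ 1]) (use that in auto)
      qed (use that in auto)
      have "emeasure (distr N S (\<lambda>x i. R i x)) E = (\<integral>\<^sup>+x. indicator A (U x) * indicator E (\<lambda>i. R i x) \<partial>M)"
        by (rule N_distr) simp
      also have "\<dots> = (\<integral>\<^sup>+x. ennreal (indicator A (U x) * indicator E (\<lambda>i. R i x)) \<partial>M)"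
        by (intro nn_integral_cong) (auto split: split_indicator)
      also have "\<dots> = ennreal (\<integral>x. indicator A (U x) * indicator E (\<lambda>i. R i x) \<partial>M)"
        by (rule en[symmetric]) (auto split: split_indicator)
      also have "\<dots> = ennreal ((\<integral>x. indicator A (U x) \<partial>M) * (\<integral>x. indicator E (\<lambda>i. R i x) \<partial>M))"
        unfolding ind using box[OF J A D'] by simp
      also have "\<dots> = ennreal (\<integral>x. indicator A (U x) \<partial>M) * ennreal (\<integral>x. indicator E (\<lambda>i. R i x) \<partial>M)"
        by (intro ennreal_mult integral_nonneg) auto
      also have "\<dots> = (\<integral>\<^sup>+x. ennreal (indicator A (U x)) \<partial>M) * (\<integral>\<^sup>+x. ennreal (indicator E (\<lambda>i. R i x)) \<partial>M)"
        by (subst (1 2) en) (auto split: split_indicator)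
      also have "(\<integral>\<^sup>+x. ennreal (indicator A (U x)) \<partial>M) = a"
        unfolding a_def by (rule nn_integral_indicator_comp) simp_all
      also have "(\<integral>\<^sup>+x. ennreal (indicator E (\<lambda>i. R i x)) \<partial>M) = emeasure (distr M S (\<lambda>x i. R i x)) E"
        by (rule nn_integral_indicator_comp) simp_all
      also have "a * emeasure (distr M S (\<lambda>x i. R i x)) E = emeasure (density (distr M S (\<lambda>x i. R i x)) (\<lambda>_. a)) E"
        by (subst emeasure_density_const) auto
      finally show "emeasure (distr N S (\<lambda>x i. R i x)) (prod_emb UNIV (\<lambda>_. borel) J (Pi\<^sub>E J D)) =
        emeasure (density (distr M S (\<lambda>x i. R i x)) (\<lambda>_. a)) (prod_emb UNIV (\<lambda>_. borel) J (Pi\<^sub>E J D))"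
        unfolding E_def .
    qed (auto simp: S_def)
    then have "a * emeasure (distr M S (\<lambda>x i. R i x)) B = emeasure (distr N S (\<lambda>x i. R i x)) B"
      by (simp add: emeasure_density_const)
    also have "\<dots> = (\<integral>\<^sup>+x. indicator A (U x) * indicator B (\<lambda>i. R i x) \<partial>M)"
      by (rule N_distr) simp
    also have "\<dots> = emeasure (distr M (borel \<Otimes>\<^sub>M S) (\<lambda>x. (U x, \<lambda>i. R i x))) (A \<times> B)"
      by (subst emeasure_distr)
         (auto simp: nn_integral_indicator[symmetric] simp del: nn_integral_indicator
               intro!: nn_integral_cong split: split_indicator)
    finally show "emeasure (distr M borel U) A * emeasure (distr M S (\<lambda>x i. R i x)) B =
      emeasure (distr M (borel \<Otimes>\<^sub>M S) (\<lambda>x. (U x, \<lambda>i. R i x))) (A \<times> B)"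
      unfolding a_def .
  qed
qed

section \<open>Gaussian integration by parts\<close>

text \<open>
  The chain rule for a function with continuous partial derivatives: moving the coordinates one at a
  time splits the increment into \<open>n\<close> one-dimensional increments, to each of which the mean value theorem
  applies; continuity of the partial derivatives lets the intermediate points collapse to \<open>a\<close>.
\<close>

lemma has_real_derivative_along_line:
  fixes f :: "(nat \<Rightarrow> real) \<Rightarrow> real" and g :: "nat \<Rightarrow> (nat \<Rightarrow> real) \<Rightarrow> real"
  assumes dep: "\<And>x y. (\<And>i. i < n \<Longrightarrow> x i = y i) \<Longrightarrow> f x = f y"
    and deriv: "\<And>i x. i < n \<Longrightarrow> ((\<lambda>y. f (x(i := y))) has_real_derivative g i x) (at (x i))"
    and cont: "\<And>i. i < n \<Longrightarrow> continuous_on UNIV (g i)"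
  shows "((\<lambda>s. f (\<lambda>i. a i + s * b i)) has_real_derivative (\<Sum>i<n. b i * g i (\<lambda>i. a i + s * b i))) (at s)"
proof -
  have at_0: "((\<lambda>h. f (\<lambda>i. a i + h * b i)) has_real_derivative (\<Sum>i<n. b i * g i a)) (at 0)" for a
  proof -
    \<comment> \<open>\<open>p m h\<close> is the point at which the coordinates below \<open>m\<close> have already been moved.\<close>
    define p where "p m h = (\<lambda>i. if i < m then a i + h * b i else a i)" for m :: nat and h :: real
    have p0: "p m 0 = a" for m by (auto simp: p_def)
    have p0': "p 0 h = a" for h by (auto simp: p_def)
    have step: "((\<lambda>h. f (p (Suc m) h) - f (p m h)) has_real_derivative b m * g m a) (at 0)"
      if m: "m < n" for m
    proof -
      define \<phi> where "\<phi> h y = f ((p m h)(m := y))" for h y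
      have \<phi>: "(\<phi> h has_real_derivative g m ((p m h)(m := y))) (at y)" for h y
        unfolding \<phi>_def using deriv[OF m, of "(p m h)(m := y)"] by simp
      have "\<exists>z. \<bar>z - a m\<bar> \<le> \<bar>h * b m\<bar> \<and> \<phi> h (a m + h * b m) - \<phi> h (a m) = h * b m * g m ((p m h)(m := z))" for h
      proof (cases "h * b m" "0::real" rule: linorder_cases)
        case less
        then obtain z where z: "a m + h * b m < z" "z < a m"
          "\<phi> h (a m) - \<phi> h (a m + h * b m) = (a m - (a m + h * b m)) * g m ((p m h)(m := z))"
          using MVT2[of "a m + h * b m" "a m" "\<phi> h"] \<phi> by force
        show ?thesis by (rule exI[of _ z]) (use z in \<open>auto simp: algebra_simps\<close>)
      next
        case greater
        then obtain z where z: "a m < z" "z < a m + h * b m"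
          "\<phi> h (a m + h * b m) - \<phi> h (a m) = (a m + h * b m - a m) * g m ((p m h)(m := z))"
          using MVT2[of "a m" "a m + h * b m" "\<phi> h"] \<phi> by force
        show ?thesis by (rule exI[of _ z]) (use z in auto)
      qed (auto intro: exI[of _ "a m"])
      then obtain z where z_le: "\<And>h. \<bar>z h - a m\<bar> \<le> \<bar>h * b m\<bar>"
        and z: "\<And>h. \<phi> h (a m + h * b m) - \<phi> h (a m) = h * b m * g m ((p m h)(m := z h))"
        by metis
      have diff: "f (p (Suc m) h) - f (p m h) = h * b m * g m ((p m h)(m := z h))" for h
      proof -
        have "(p m h)(m := a m + h * b m) = p (Suc m) h" "(p m h)(m := a m) = p m h"
          by (auto simp: p_def less_Suc_eq)
        then show ?thesis using z[of h] by (simp add: \<phi>_def)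
      qed
      have "((\<lambda>h. \<bar>h * b m\<bar>) \<longlongrightarrow> \<bar>0 * b m\<bar>) (at 0)" by (intro tendsto_intros)
      then have null: "((\<lambda>h. \<bar>h * b m\<bar>) \<longlongrightarrow> 0) (at 0)" by simp
      have "((\<lambda>h. z h - a m) \<longlongrightarrow> 0) (at 0)"
        by (rule Lim_null_comparison[OF _ null]) (simp add: z_le)
      then have z_lim: "(z \<longlongrightarrow> a m) (at 0)"
        by (rule LIM_zero_cancel)
      have "((\<lambda>h. (p m h)(m := z h)) \<longlongrightarrow> a) (at 0)"
      proof -
        have "((\<lambda>h. ((p m h)(m := z h)) i) \<longlongrightarrow> a i) (at 0)" for i
        proof -
          have "((\<lambda>h. a i + h * b i) \<longlongrightarrow> a i + 0 * b i) (at 0)" by (intro tendsto_intros)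
          then show ?thesis using z_lim by (cases "i = m"; cases "i < m") (simp_all add: p_def)
        qed
        then have "limitin (product_topology (\<lambda>_. euclidean) UNIV) (\<lambda>h. (p m h)(m := z h)) a (at 0)"
          unfolding limitin_componentwise limitin_canonical_iff by simp
        then show ?thesis unfolding euclidean_product_topology limitin_canonical_iff .
      qed
      moreover have "isCont (g m) a" using cont[OF m] by (simp add: continuous_on_eq_continuous_at)
      ultimately have "((\<lambda>h. g m ((p m h)(m := z h))) \<longlongrightarrow> g m a) (at 0)"
        by (rule isCont_tendsto_compose[rotated])
      then have "((\<lambda>h. b m * g m ((p m h)(m := z h))) \<longlongrightarrow> b m * g m a) (at 0)"
        by (intro tendsto_intros)
      moreover have "\<forall>\<^sub>F h in at 0. b m * g m ((p m h)(m := z h)) =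
          ((f (p (Suc m) h) - f (p m h)) - (f (p (Suc m) 0) - f (p m 0))) / (h - 0)"
        unfolding p0 diff by (auto simp: eventually_at_filter)
      ultimately show ?thesis
        unfolding has_field_derivative_iff by (rule Lim_transform_eventually)
    qed
    have "((\<lambda>h. \<Sum>m<n. f (p (Suc m) h) - f (p m h)) has_real_derivative (\<Sum>m<n. b m * g m a)) (at 0)"
      by (rule DERIV_sum) (use step in auto)
    moreover have "(\<Sum>m<n. f (p (Suc m) h) - f (p m h)) = f (\<lambda>i. a i + h * b i) - f a" for h
    proof -
      have "f (p n h) = f (\<lambda>i. a i + h * b i)" by (rule dep) (simp add: p_def)
      then show ?thesis using sum_lessThan_telescope[of "\<lambda>m. f (p m h)" n] by (simp add: p0')
    qed
    ultimately have "((\<lambda>h. f (\<lambda>i. a i + h * b i) - f a) has_real_derivative (\<Sum>m<n. b m * g m a)) (at 0)"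
      by simp
    from DERIV_add[OF this DERIV_const[of "f a"]] show ?thesis by simp
  qed
  from at_0[of "\<lambda>i. a i + s * b i"]
  have "((\<lambda>h. f (\<lambda>i. a i + (h + s) * b i)) has_real_derivative (\<Sum>i<n. b i * g i (\<lambda>i. a i + s * b i))) (at 0)"
    by (simp add: algebra_simps)
  then show ?thesis using DERIV_shift[of "\<lambda>s. f (\<lambda>i. a i + s * b i)" _ 0 s] by simp
qed

text \<open>
  Stein's identity. The standard normal density \<open>\<phi>\<close> satisfies \<open>\<phi>' y = - y \<phi> y\<close>, so the integrand
  against \<open>\<phi>\<close> is the derivative of \<open>- \<phi> g\<close>, which vanishes at both ends of the line.
\<close>

lemma stein_std_normal:
  fixes g g' :: "real \<Rightarrow> real"
  assumes deriv: "\<And>y. (g has_real_derivative g' y) (at y)"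
    and cont: "continuous_on UNIV g'"
    and bounded: "\<And>y. \<bar>g y\<bar> \<le> B" "\<And>y. \<bar>g' y\<bar> \<le> B"
  shows "integrable std_normal_distribution (\<lambda>y. y * g y - g' y)"
    and "(\<integral>y. y * g y - g' y \<partial>std_normal_distribution) = 0"
proof -
  let ?\<phi> = std_normal_density
  have cg: "continuous_on UNIV g" using deriv by (meson DERIV_isCont continuous_at_imp_continuous_on)
  have [measurable]: "g \<in> borel_measurable borel" "g' \<in> borel_measurable borel"
    by (intro borel_measurable_continuous_onI cg cont)+
  have d\<phi>: "(?\<phi> has_real_derivative - y * ?\<phi> y) (at y)" for y
  proof -
    have "((\<lambda>x. c * exp (- x\<^sup>2 / 2)) has_real_derivative - y * (c * exp (- y\<^sup>2 / 2))) (at y)" for c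
      by (auto intro!: derivative_eq_intros)
    then show ?thesis unfolding std_normal_density_def .
  qed
  have int: "integrable lborel (\<lambda>y. ?\<phi> y * (y * g y - g' y))"
  proof (rule Bochner_Integration.integrable_bound)
    show "integrable lborel (\<lambda>y. B * (?\<phi> y * \<bar>y\<bar>^1) + B * (?\<phi> y * \<bar>y\<bar>^0))"
      by (intro Bochner_Integration.integrable_add integrable_mult_right integrable_std_normal_moment_abs)
    show "AE y in lborel. norm (?\<phi> y * (y * g y - g' y)) \<le> norm (B * (?\<phi> y * \<bar>y\<bar>^1) + B * (?\<phi> y * \<bar>y\<bar>^0))"
    proof (rule AE_I2)
      fix y
      have "\<bar>y * g y - g' y\<bar> \<le> \<bar>y\<bar> * \<bar>g y\<bar> + \<bar>g' y\<bar>"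
        using abs_triangle_ineq4[of "y * g y" "g' y"] by (simp add: abs_mult)
      also have "\<dots> \<le> \<bar>y\<bar> * B + B"
        by (intro add_mono mult_left_mono bounded) auto
      finally have "?\<phi> y * \<bar>y * g y - g' y\<bar> \<le> ?\<phi> y * (\<bar>y\<bar> * B + B)"
        by (intro mult_left_mono) auto
      also have "\<dots> = B * (?\<phi> y * \<bar>y\<bar>^1) + B * (?\<phi> y * \<bar>y\<bar>^0)"
        by (simp add: algebra_simps)
      finally have "\<bar>?\<phi> y\<bar> * \<bar>y * g y - g' y\<bar> \<le> \<bar>B * (?\<phi> y * \<bar>y\<bar>^1) + B * (?\<phi> y * \<bar>y\<bar>^0)\<bar>"
        by simp
      then show "norm (?\<phi> y * (y * g y - g' y)) \<le> norm (B * (?\<phi> y * \<bar>y\<bar>^1) + B * (?\<phi> y * \<bar>y\<bar>^0))"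
        by (simp only: real_norm_def abs_mult)
    qed
  qed measurable
  have lim: "((\<lambda>y. - (?\<phi> y * g y)) \<longlongrightarrow> 0) F" if "(?\<phi> \<longlongrightarrow> 0) F" for F
  proof (rule Lim_null_comparison)
    show "\<forall>\<^sub>F y in F. norm (- (?\<phi> y * g y)) \<le> ?\<phi> y * B"
      by (intro always_eventually) (auto simp: abs_mult intro!: mult_left_mono bounded)
    show "((\<lambda>y. ?\<phi> y * B) \<longlongrightarrow> 0) F" using that by (rule tendsto_mult_left_zero)
  qed
  have top: "(?\<phi> \<longlongrightarrow> 0) at_top" and bot: "(?\<phi> \<longlongrightarrow> 0) at_bot"
    unfolding std_normal_density_def by real_asymp+
  have "(LBINT y=-\<infinity>..\<infinity>. ?\<phi> y * (y * g y - g' y)) = 0 - 0"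
  proof (rule interval_integral_FTC_integrable)
    show "((\<lambda>y. - (?\<phi> y * g y)) has_vector_derivative ?\<phi> y * (y * g y - g' y)) (at y)" for y
      unfolding has_real_derivative_iff_has_vector_derivative[symmetric]
      by (auto intro!: derivative_eq_intros d\<phi> deriv simp: algebra_simps)
    show "isCont (\<lambda>y. ?\<phi> y * (y * g y - g' y)) y" for y
    proof -
      have "isCont g y" "isCont g' y" using cg cont by (auto simp: continuous_on_eq_continuous_at)
      moreover have "isCont ?\<phi> y" using d\<phi> by (rule DERIV_isCont)
      ultimately show ?thesis by (intro continuous_intros)
    qed
    show "set_integrable lborel (einterval (-\<infinity>) \<infinity>) (\<lambda>y. ?\<phi> y * (y * g y - g' y))"
      using int by (simp add: set_integrable_def)
    show "(((\<lambda>y. - (?\<phi> y * g y)) \<circ> real_of_ereal) \<longlongrightarrow> 0) (at_right (-\<infinity>))"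
      "(((\<lambda>y. - (?\<phi> y * g y)) \<circ> real_of_ereal) \<longlongrightarrow> 0) (at_left \<infinity>)"
      unfolding ereal_tendsto_simps by (intro lim top bot)+
  qed simp
  then have "(\<integral>y. ?\<phi> y * (y * g y - g' y) \<partial>lborel) = 0"
    by (simp add: interval_lebesgue_integral_def set_lebesgue_integral_def)
  then show "(\<integral>y. y * g y - g' y \<partial>std_normal_distribution) = 0"
    by (subst integral_density) auto
  show "integrable std_normal_distribution (\<lambda>y. y * g y - g' y)"
    using int by (subst integrable_density) auto
qed

lemma schwartz_depends:
  "schwartz n f \<Longrightarrow> (\<And>i. i < n \<Longrightarrow> x i = y i) \<Longrightarrow> f x = f y"
  unfolding schwartz_def by blast

lemma schwartz_has_partial_deriv:
  assumes f: "schwartz n f" and i: "i < n"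
  shows "((\<lambda>y. f (x(i := y))) has_real_derivative partial_deriv i f x) (at (x i))"
proof -
  have "(\<lambda>y. f (x(i := y))) field_differentiable (at (x i))"
    using f i unfolding schwartz_def by (auto dest!: spec[of _ "[]"])
  then show ?thesis
    unfolding partial_deriv_def by (rule field_differentiable_derivI)
qed

lemma schwartz_continuous: "schwartz n f \<Longrightarrow> continuous_on UNIV f"
  unfolding schwartz_def by (auto dest!: spec[of _ "[]"])

lemma schwartz_partial_deriv_continuous: "schwartz n f \<Longrightarrow> i < n \<Longrightarrow> continuous_on UNIV (partial_deriv i f)"
  unfolding schwartz_def by (auto dest!: spec[of _ "[i]"])

lemma schwartz_iterated_bounded:
  assumes "schwartz n f" "set is \<subseteq> {..<n}"
  shows "\<exists>C. \<forall>x. \<bar>foldr partial_deriv is f x\<bar> \<le> C"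
proof -
  have "\<forall>k. \<exists>C. \<forall>x. (1 + (\<Sum>i<n. \<bar>x i\<bar>)) ^ k * \<bar>foldr partial_deriv is f x\<bar> \<le> C"
    using assms unfolding schwartz_def by blast
  from spec[OF this, of 0] show ?thesis by simp
qed

lemma schwartz_bounded: "schwartz n f \<Longrightarrow> \<exists>C. \<forall>x. \<bar>f x\<bar> \<le> C"
  using schwartz_iterated_bounded[of n f "[]"] by simp

lemma schwartz_partial_deriv_bounded: "schwartz n f \<Longrightarrow> i < n \<Longrightarrow> \<exists>C. \<forall>x. \<bar>partial_deriv i f x\<bar> \<le> C"
  using schwartz_iterated_bounded[of n f "[i]"] by simp

text \<open>
  Joint Gaussianity enters only through the characteristic functions of finite linear combinations, which
  allows degenerate covariances. If \<open>Y0\<close> vanishes almost surely, so do both sides; otherwise \<open>Y0\<close> is normalised to \<open>U\<close>, and the projections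
  of the \<open>Y i\<close> onto \<open>U\<close> are split off.
\<close>

theorem (in prob_space) gaussian_integration_by_parts:
  fixes Y0 :: "'a \<Rightarrow> real" and Y :: "nat \<Rightarrow> 'a \<Rightarrow> real"
  assumes Y0: "Y0 \<in> L2 M" and Y: "\<And>i. Y i \<in> L2 M"
    and gauss: "\<And>s \<xi> K. finite K \<Longrightarrow>
      (\<integral>x. iexp (s * Y0 x + (\<Sum>i\<in>K. \<xi> i * Y i x)) \<partial>M) =
      exp (- L2_sqnorm M (\<lambda>x. s * Y0 x + (\<Sum>i\<in>K. \<xi> i * Y i x)) / 2)"
    and f: "schwartz n f"
  shows "(\<integral>x. Y0 x * f (\<lambda>i. Y i x) \<partial>M) =
    (\<Sum>i<n. (\<integral>x. Y0 x * Y i x \<partial>M) * (\<integral>x. partial_deriv i f (\<lambda>j. Y j x) \<partial>M))"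
proof -
  define S where "S = PiM (UNIV :: nat set) (\<lambda>_. borel :: real measure)"
  have S: "sets S = sets borel" unfolding S_def by (rule sets_PiM_equal_borel)
  note [measurable] = L2_measurable[OF Y0] L2_measurable[OF Y]
  have YS: "(\<lambda>x i. Y i x) \<in> measurable M S"
    unfolding S_def by (rule measurable_PiM_single') auto
  have f_m [measurable]: "f \<in> borel_measurable S"
    unfolding measurable_cong_sets[OF S refl]
    by (intro borel_measurable_continuous_onI schwartz_continuous[OF f])
  have pd_m: "partial_deriv i f \<in> borel_measurable S" if "i < n" for i
    unfolding measurable_cong_sets[OF S refl]
    by (intro borel_measurable_continuous_onI schwartz_partial_deriv_continuous[OF f that])
  obtain C where C: "\<And>x. \<bar>f x\<bar> \<le> C" using schwartz_bounded[OF f] by blast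
  have fY: "(\<lambda>x. f (\<lambda>i. Y i x)) \<in> L2 M"
    by (rule L2_bounded[of _ _ C]) (use C in \<open>auto intro: finite_measure_axioms measurable_compose[OF YS f_m]\<close>)
  define v where "v = L2_sqnorm M Y0"
  show ?thesis
  proof (cases "v = 0")
    case True
    have "(\<integral>x. Y0 x * g x \<partial>M) = 0" if "g \<in> L2 M" for g
      using L2_cauchy_schwarz[OF Y0 that] True by (simp add: v_def)
    then show ?thesis using fY Y by simp
  next
    case False
    then have v: "v > 0" using L2_sqnorm_nonneg[of M Y0] by (simp add: v_def)
    define \<sigma> where "\<sigma> = sqrt v"
    have \<sigma>: "\<sigma> > 0" "\<sigma> * \<sigma> = v" using v by (auto simp: \<sigma>_def)
    define U where "U x = Y0 x / \<sigma>" for x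
    define b where "b i = (\<integral>x. Y0 x * Y i x \<partial>M) / \<sigma>" for i
    define R where "R i x = Y i x - b i * U x" for i x
    have U: "U \<in> L2 M" using L2_cmult[OF Y0, of "1/\<sigma>"] by (simp add: U_def[abs_def])
    have R: "R i \<in> L2 M" for i unfolding R_def by (intro L2_diff Y L2_cmult U)
    note [measurable] = L2_measurable[OF U] L2_measurable[OF R]
    have UU: "L2_sqnorm M U = 1"
    proof -
      have "L2_sqnorm M U = (1/\<sigma>)\<^sup>2 * v"
        unfolding v_def L2_sqnorm_cmult[symmetric] by (simp add: U_def[abs_def])
      then show ?thesis using \<sigma> v by (simp add: power2_eq_square)
    qed
    have UR: "(\<integral>x. U x * R i x \<partial>M) = 0" for i
    proof -
      have "(\<integral>x. U x * R i x \<partial>M) = (\<integral>x. U x * Y i x - b i * (U x * U x) \<partial>M)"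
        by (simp add: R_def algebra_simps)
      also have "\<dots> = (\<integral>x. U x * Y i x \<partial>M) - b i * L2_sqnorm M U"
        using L2_mult_integrable[OF U Y] L2_mult_integrable[OF U U] by (simp add: L2_sqnorm_mult)
      also have "(\<integral>x. U x * Y i x \<partial>M) = b i" by (simp add: U_def b_def)
      finally show ?thesis using UU by simp
    qed
    \<comment> \<open>\<open>U\<close> is orthogonal to every \<open>R i\<close>, so the variances add up and the characteristic function factorises.\<close>
    have gaussUR: "(\<integral>x. iexp (s * U x + (\<Sum>i\<in>K. \<xi> i * R i x)) \<partial>M) =
        exp (- (s\<^sup>2 + L2_sqnorm M (\<lambda>x. \<Sum>i\<in>K. \<xi> i * R i x)) / 2)" if K: "finite K" for s \<xi> K
    proof -
      have RK: "(\<lambda>x. \<Sum>i\<in>K. \<xi> i * R i x) \<in> L2 M" by (intro L2_sum L2_cmult R)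
      have "(\<integral>x. (\<Sum>i\<in>K. \<xi> i * R i x) * U x \<partial>M) = (\<integral>x. (\<Sum>i\<in>K. \<xi> i * (U x * R i x)) \<partial>M)"
        by (simp add: sum_distrib_left algebra_simps)
      also have "\<dots> = (\<Sum>i\<in>K. \<xi> i * (\<integral>x. U x * R i x \<partial>M))"
        using L2_mult_integrable[OF U R] by simp
      finally have orth: "(\<integral>x. (\<Sum>i\<in>K. \<xi> i * R i x) * U x \<partial>M) = 0" by (simp add: UR)
      have eq: "s * U x + (\<Sum>i\<in>K. \<xi> i * R i x) =
          ((s - (\<Sum>i\<in>K. \<xi> i * b i)) / \<sigma>) * Y0 x + (\<Sum>i\<in>K. \<xi> i * Y i x)" for x
        by (simp add: R_def U_def algebra_simps sum_subtractf sum_distrib_left sum_distrib_right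
            diff_divide_distrib sum_divide_distrib)
      have "(\<integral>x. iexp (s * U x + (\<Sum>i\<in>K. \<xi> i * R i x)) \<partial>M) =
          exp (- L2_sqnorm M (\<lambda>x. s * U x + (\<Sum>i\<in>K. \<xi> i * R i x)) / 2)"
        unfolding eq by (rule gauss[OF K])
      also have "L2_sqnorm M (\<lambda>x. s * U x + (\<Sum>i\<in>K. \<xi> i * R i x)) =
          s\<^sup>2 + L2_sqnorm M (\<lambda>x. \<Sum>i\<in>K. \<xi> i * R i x)"
        using L2_sqnorm_add_scaled[OF RK U, of s] by (simp add: orth UU add.commute)
      finally show ?thesis .
    qed
    have gaussU: "(\<integral>x. iexp (s * U x) \<partial>M) = exp (- s\<^sup>2 / 2)" for s
      using gaussUR[of "{}" s] by (simp add: L2_sqnorm_def)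
    have gaussR: "(\<integral>x. iexp (\<Sum>i\<in>K. \<xi> i * R i x) \<partial>M) = exp (- L2_sqnorm M (\<lambda>x. \<Sum>i\<in>K. \<xi> i * R i x) / 2)"
      if "finite K" for \<xi> K
      using gaussUR[OF that, of 0] by simp
    have law: "distr M borel U \<Otimes>\<^sub>M distr M S (\<lambda>x i. R i x) =
        distr M (borel \<Otimes>\<^sub>M S) (\<lambda>x. (U x, \<lambda>i. R i x))"
      unfolding S_def
    proof (rule joint_law_eq_product)
      fix s \<xi> and K :: "nat set" assume K: "finite K"
      have "(\<integral>x. iexp (s * U x) * iexp (\<Sum>i\<in>K. \<xi> i * R i x) \<partial>M) =
          (\<integral>x. iexp (s * U x + (\<Sum>i\<in>K. \<xi> i * R i x)) \<partial>M)"
        by (simp add: exp_add[symmetric] distrib_left)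
      then show "(\<integral>x. iexp (s * U x) * iexp (\<Sum>i\<in>K. \<xi> i * R i x) \<partial>M) =
          (\<integral>x. iexp (s * U x) \<partial>M) * (\<integral>x. iexp (\<Sum>i\<in>K. \<xi> i * R i x) \<partial>M)"
        unfolding gaussUR[OF K] gaussU gaussR[OF K]
        by (simp only: of_real_mult[symmetric] exp_add[symmetric] add_divide_distrib minus_add_distrib)
    qed auto
    have lawU: "distr M borel U = std_normal_distribution"
    proof (rule Levy_uniqueness)
      show "real_distribution (distr M borel U)" by (rule real_distribution_distr) simp
      show "real_distribution std_normal_distribution" by (rule real_dist_normal_dist)
      show "char (distr M borel U) = char std_normal_distribution"
      proof
        fix t
        have "char (distr M borel U) t = (\<integral>x. iexp (t * U x) \<partial>M)"
          unfolding char_def by (rule integral_distr) auto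
        then show "char (distr M borel U) t = char std_normal_distribution t"
          unfolding gaussU by (simp add: char_std_normal_distribution)
      qed
    qed
    have RS [measurable]: "(\<lambda>x i. R i x) \<in> measurable M S"
      unfolding S_def by (rule measurable_PiM_single') auto
    define line where "line u r = (\<lambda>i. r i + u * b i)" for u :: real and r :: "nat \<Rightarrow> real"
    have line_m [measurable]: "(\<lambda>(u, r). line u r) \<in> measurable (borel \<Otimes>\<^sub>M S) S"
    proof -
      have [measurable]: "(\<lambda>r. r i) \<in> borel_measurable S" for i
        unfolding S_def by (rule measurable_component_singleton) simp
      show ?thesis
        unfolding S_def[symmetric] line_def case_prod_beta
        by (subst S_def, rule measurable_PiM_single') auto
    qed
    define D where "D r = (\<Sum>i<n. b i * partial_deriv i f r)" for r
    have D_m [measurable]: "D \<in> borel_measurable S"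
      unfolding D_def by (intro borel_measurable_sum borel_measurable_times) (use pd_m in auto)
    have "\<forall>i. \<exists>C. i < n \<longrightarrow> (\<forall>x. \<bar>partial_deriv i f x\<bar> \<le> C)"
      using schwartz_partial_deriv_bounded[OF f] by blast
    then obtain C' where C': "\<And>i x. i < n \<Longrightarrow> \<bar>partial_deriv i f x\<bar> \<le> C' i" by metis
    define B where "B = (\<Sum>i<n. \<bar>b i\<bar> * C' i)"
    have B: "\<bar>D x\<bar> \<le> B" for x
    proof -
      have "\<bar>D x\<bar> \<le> (\<Sum>i<n. \<bar>b i * partial_deriv i f x\<bar>)" unfolding D_def by (rule sum_abs)
      also have "\<dots> \<le> B"
        unfolding B_def abs_mult by (intro sum_mono mult_left_mono C') simp_all
      finally show ?thesis .
    qed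
    \<comment> \<open>Along the line through \<open>r\<close> in direction \<open>b\<close> this has mean zero under the standard normal law,
       by Stein's identity; its mean at \<open>(U, R)\<close> is the difference of the two sides of the claim, divided by \<open>\<sigma>\<close>.\<close>
    define k where "k u r = u * f (line u r) - D (line u r)" for u r
    have k_m [measurable]: "(\<lambda>(u, r). k u r) \<in> borel_measurable (borel \<Otimes>\<^sub>M S)"
      unfolding k_def by measurable
    have stein: "(\<integral>u. k u r \<partial>std_normal_distribution) = 0" for r
      unfolding k_def
    proof (rule stein_std_normal(2))
      show "((\<lambda>u. f (line u r)) has_real_derivative D (line u r)) (at u)" for u
        unfolding D_def line_def
      proof (rule has_real_derivative_along_line)
        show "f x = f y" if "\<And>i. i < n \<Longrightarrow> x i = y i" for x y
          by (rule schwartz_depends[OF f that])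
      qed (rule schwartz_has_partial_deriv[OF f] schwartz_partial_deriv_continuous[OF f], assumption)+
      show "\<bar>f (line u r)\<bar> \<le> max B C" "\<bar>D (line u r)\<bar> \<le> max B C" for u
        using B[of "line u r"] C[of "line u r"] by linarith+
      have "continuous_on UNIV D"
        unfolding D_def by (intro continuous_intros schwartz_partial_deriv_continuous[OF f]) auto
      moreover have "continuous_on UNIV (\<lambda>u. line u r)"
        unfolding line_def by (intro continuous_on_coordinatewise_then_product continuous_intros)
      ultimately show "continuous_on UNIV (\<lambda>u. D (line u r))"
        by (rule continuous_on_compose2) auto
    qed
    have lineUR: "line (U x) (\<lambda>i. R i x) = (\<lambda>i. Y i x)" for x
      by (auto simp: line_def R_def)
    have DY: "integrable M (\<lambda>x. D (\<lambda>i. Y i x))"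
      by (rule integrable_const_bound[of _ B])
         (use B in \<open>auto intro: measurable_compose[OF YS D_m]\<close>)
    have UfY: "integrable M (\<lambda>x. U x * f (\<lambda>i. Y i x))"
      by (rule L2_mult_integrable[OF U fY])
    have "(\<integral>x. U x * f (\<lambda>i. Y i x) - D (\<lambda>i. Y i x) \<partial>M) = (\<integral>x. k (U x) (\<lambda>i. R i x) \<partial>M)"
      by (simp add: k_def lineUR)
    also have "\<dots> = (\<integral>p. (\<lambda>(u, r). k u r) p \<partial>distr M (borel \<Otimes>\<^sub>M S) (\<lambda>x. (U x, \<lambda>i. R i x)))"
      by (subst integral_distr) auto
    also have "\<dots> = (\<integral>p. (\<lambda>(u, r). k u r) p \<partial>(distr M borel U \<Otimes>\<^sub>M distr M S (\<lambda>x i. R i x)))"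
      by (simp add: law)
    also have "\<dots> = (\<integral>r. (\<integral>u. k u r \<partial>distr M borel U) \<partial>distr M S (\<lambda>x i. R i x))"
    proof -
      interpret dU: prob_space "distr M borel U" by (rule prob_space_distr) simp
      interpret dR: prob_space "distr M S (\<lambda>x i. R i x)" by (rule prob_space_distr) simp
      interpret pair_sigma_finite "distr M borel U" "distr M S (\<lambda>x i. R i x)" ..
      have "integrable (distr M (borel \<Otimes>\<^sub>M S) (\<lambda>x. (U x, \<lambda>i. R i x))) (\<lambda>(u, r). k u r)"
        by (subst integrable_distr_eq) (use DY UfY in \<open>auto simp: k_def lineUR\<close>)
      then have "integrable (distr M borel U \<Otimes>\<^sub>M distr M S (\<lambda>x i. R i x)) (\<lambda>(u, r). k u r)"
        unfolding law .
      from integral_snd[OF this] show ?thesis by simp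
    qed
    also have "\<dots> = 0" unfolding lawU stein by simp
    finally have main: "(\<integral>x. U x * f (\<lambda>i. Y i x) \<partial>M) = (\<integral>x. D (\<lambda>i. Y i x) \<partial>M)"
      using UfY DY by simp
    have "(\<integral>x. Y0 x * f (\<lambda>i. Y i x) \<partial>M) = \<sigma> * (\<integral>x. U x * f (\<lambda>i. Y i x) \<partial>M)"
      using \<sigma> by (simp add: U_def)
    also have "\<dots> = \<sigma> * (\<Sum>i<n. b i * (\<integral>x. partial_deriv i f (\<lambda>j. Y j x) \<partial>M))"
    proof -
      have "integrable M (\<lambda>x. partial_deriv i f (\<lambda>j. Y j x))" if "i < n" for i
        by (rule integrable_const_bound[of _ "C' i"])
           (use C' that in \<open>auto intro: measurable_compose[OF YS pd_m]\<close>)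
      then show ?thesis unfolding main D_def by (subst Bochner_Integration.integral_sum) auto
    qed
    also have "\<dots> = (\<Sum>i<n. (\<integral>x. Y0 x * Y i x \<partial>M) * (\<integral>x. partial_deriv i f (\<lambda>j. Y j x) \<partial>M))"
      using \<sigma> by (simp add: sum_distrib_left b_def)
    finally show ?thesis .
  qed
qed

section \<open>The Gaussian space of a process\<close>

text \<open>
  The degenerate case is a constant, which must be \<open>0\<close>; it satisfies the same formula with variance \<open>0\<close>.
\<close>

lemma (in prob_space) centered_gaussian_rv_L2_char:
  assumes Y: "gaussian_rv M Y" and mean: "(\<integral>x. Y x \<partial>M) = 0"
  shows "Y \<in> L2 M" "(\<integral>x. iexp (Y x) \<partial>M) = exp (- L2_sqnorm M Y / 2)"
proof -
  have [measurable]: "Y \<in> borel_measurable M" using Y by (simp add: gaussian_rv_def)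
  have "Y \<in> L2 M \<and> (\<integral>x. iexp (Y x) \<partial>M) = exp (- L2_sqnorm M Y / 2)"
  proof (cases "\<exists>m. AE x in M. Y x = m")
    case True
    then obtain m where m: "AE x in M. Y x = m" by blast
    have "(\<integral>x. Y x \<partial>M) = (\<integral>x. m \<partial>M)" by (rule integral_cong_AE) (use m in auto)
    then have "m = 0" using mean by (simp add: prob_space)
    with m have Y0: "AE x in M. Y x = 0" by simp
    have "integrable M (\<lambda>x. (norm (Y x))\<^sup>2)"
      by (rule integrable_cong_AE_imp[of M "\<lambda>_. 0"]) (use Y0 in auto)
    moreover have "L2_sqnorm M Y = (\<integral>x. 0 \<partial>M)"
      unfolding L2_sqnorm_def by (rule integral_cong_AE) (use Y0 in auto)
    moreover have "(\<integral>x. iexp (Y x) \<partial>M) = (\<integral>x. 1 \<partial>M)"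
      by (rule integral_cong_AE) (use Y0 in auto)
    ultimately show ?thesis by (simp add: L2_def prob_space)
  next
    case False
    then obtain m \<sigma> where \<sigma>: "0 < \<sigma>" and dist: "distributed M lborel Y (normal_density m \<sigma>)"
      using Y unfolding gaussian_rv_def by blast
    have m: "m = 0" using normal_distributed_expectation[OF \<sigma> dist] mean by simp
    have var: "L2_sqnorm M Y = \<sigma>\<^sup>2"
      using normal_distributed_variance[OF \<sigma> dist] mean by (simp add: L2_sqnorm_def)
    have "integrable M (\<lambda>x. (Y x)\<^sup>2)"
    proof (rule ccontr)
      assume "\<not> integrable M (\<lambda>x. (Y x)\<^sup>2)"
      then have "L2_sqnorm M Y = 0" by (simp add: L2_sqnorm_def not_integrable_integral_eq)
      then show False using var \<sigma> by simp
    qed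
    then have L2: "Y \<in> L2 M" by (simp add: L2_def)
    have "distributed M lborel (\<lambda>x. (Y x - 0) / \<sigma>) std_normal_density"
      using dist normal_standard_normal_convert[OF \<sigma>, of Y 0] unfolding m by simp
    then have law: "distr M lborel (\<lambda>x. Y x / \<sigma>) = std_normal_distribution"
      by (simp add: distributed_def)
    have "(\<integral>x. iexp (Y x) \<partial>M) = (\<integral>x. iexp (\<sigma> * (Y x / \<sigma>)) \<partial>M)" using \<sigma> by simp
    also have "\<dots> = char (distr M lborel (\<lambda>x. Y x / \<sigma>)) \<sigma>"
      unfolding char_def by (rule integral_distr[symmetric]) auto
    also have "\<dots> = exp (- L2_sqnorm M Y / 2)"
      unfolding law var char_std_normal_distribution by simp
    finally show ?thesis using L2 by simp
  qed
  then show "Y \<in> L2 M" "(\<integral>x. iexp (Y x) \<partial>M) = exp (- L2_sqnorm M Y / 2)" by auto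
qed

lemma cmod_iexp_diff_le: "cmod (iexp a - iexp b) \<le> \<bar>a - b\<bar>"
proof -
  have "cmod (iexp a - iexp b) = cmod (iexp b * (iexp (a - b) - 1))"
    by (simp add: algebra_simps exp_add[symmetric])
  also have "\<dots> = cmod (iexp (a - b) - 1)" by (simp add: norm_mult)
  also have "\<dots> \<le> \<bar>a - b\<bar>" using iexp_approx1[of "a - b" 0] by simp
  finally show ?thesis .
qed

text \<open>
  The process \<open>Z\<close> plays the part of the noise \<open>Xu\<close>; its index set is the whole space of \<open>\<mu>\<close>.
\<close>

locale gaussian_noise = P: prob_space P + \<mu>: finite_measure \<mu>
  for P :: "'w measure" and \<mu> :: "real measure" +
  fixes Z :: "real \<Rightarrow> 'w \<Rightarrow> real"
  assumes Z_pair_measurable: "(\<lambda>(\<omega>, t). Z t \<omega>) \<in> borel_measurable (P \<Otimes>\<^sub>M \<mu>)"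
    and gaussian: "centered_gaussian_process P (space \<mu>) Z"
    and trace: "integrable \<mu> (\<lambda>t. cov P Z t t)"
begin

sublocale PM: pair_sigma_finite P \<mu> ..

definition lin_span :: "('w \<Rightarrow> real) set" where
  "lin_span = {V. \<exists>I c. finite I \<and> I \<subseteq> space \<mu> \<and> V = (\<lambda>\<omega>. \<Sum>t\<in>I. c t * Z t \<omega>)}"

text \<open>
  The closure of the span in \<open>L\<^sup>2\<close>, known as the first Wiener chaos.
\<close>

definition gaussian_space :: "('w \<Rightarrow> real) set" where
  "gaussian_space = {Y \<in> L2 P. \<forall>e>0. \<exists>V\<in>lin_span. L2_sqnorm P (\<lambda>\<omega>. V \<omega> - Y \<omega>) < e}"

lemma Z_in_span: "t \<in> space \<mu> \<Longrightarrow> Z t \<in> lin_span"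
  unfolding lin_span_def by (intro CollectI exI[of _ "{t}"] exI[of _ "\<lambda>_. 1"]) auto

lemma Z_gaussian:
  assumes "t \<in> space \<mu>"
  shows "gaussian_rv P (Z t)" "(\<integral>\<omega>. Z t \<omega> \<partial>P) = 0"
proof -
  have "gaussian_rv P (\<lambda>\<omega>. \<Sum>t\<in>{t}. 1 * Z t \<omega>)"
    using gaussian assms unfolding centered_gaussian_process_def
    by (elim conjE allE[of _ "{t}"] allE[of _ "\<lambda>_. 1"]) auto
  then show "gaussian_rv P (Z t)" by simp
  show "(\<integral>\<omega>. Z t \<omega> \<partial>P) = 0"
    using gaussian assms unfolding centered_gaussian_process_def by blast
qed

lemma Z_L2: "t \<in> space \<mu> \<Longrightarrow> Z t \<in> L2 P"
  by (rule P.centered_gaussian_rv_L2_char(1)[OF Z_gaussian])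

lemma span_L2_char:
  assumes "V \<in> lin_span"
  shows "V \<in> L2 P" "(\<integral>\<omega>. iexp (V \<omega>) \<partial>P) = exp (- L2_sqnorm P V / 2)"
proof -
  obtain I c where I: "finite I" "I \<subseteq> space \<mu>" and V: "V = (\<lambda>\<omega>. \<Sum>t\<in>I. c t * Z t \<omega>)"
    using assms unfolding lin_span_def by blast
  have "gaussian_rv P V"
    using gaussian I unfolding centered_gaussian_process_def V by blast
  moreover have "(\<integral>\<omega>. V \<omega> \<partial>P) = (\<Sum>t\<in>I. c t * (\<integral>\<omega>. Z t \<omega> \<partial>P))"
    unfolding V using I by (subst Bochner_Integration.integral_sum)
      (auto intro!: integrable_mult_right L2_integrable P.finite_measure_axioms Z_L2)
  then have "(\<integral>\<omega>. V \<omega> \<partial>P) = 0" using I Z_gaussian(2) by (simp add: subset_eq)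
  ultimately show "V \<in> L2 P" "(\<integral>\<omega>. iexp (V \<omega>) \<partial>P) = exp (- L2_sqnorm P V / 2)"
    by (rule P.centered_gaussian_rv_L2_char)+
qed

lemma span_add_scaled:
  assumes "V \<in> lin_span" "W \<in> lin_span"
  shows "(\<lambda>\<omega>. V \<omega> + a * W \<omega>) \<in> lin_span"
proof -
  obtain I c where I: "finite I" "I \<subseteq> space \<mu>" and V: "V = (\<lambda>\<omega>. \<Sum>t\<in>I. c t * Z t \<omega>)"
    using assms(1) unfolding lin_span_def by blast
  obtain K d where K: "finite K" "K \<subseteq> space \<mu>" and W: "W = (\<lambda>\<omega>. \<Sum>t\<in>K. d t * Z t \<omega>)"
    using assms(2) unfolding lin_span_def by blast
  define e where "e t = (if t \<in> I then c t else 0) + a * (if t \<in> K then d t else 0)" for t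
  have "V \<omega> + a * W \<omega> = (\<Sum>t\<in>I \<union> K. e t * Z t \<omega>)" for \<omega>
  proof -
    have "V \<omega> = (\<Sum>t\<in>I \<union> K. (if t \<in> I then c t else 0) * Z t \<omega>)"
      unfolding V by (rule sum.mono_neutral_cong_left) (use I K in auto)
    moreover have "W \<omega> = (\<Sum>t\<in>I \<union> K. (if t \<in> K then d t else 0) * Z t \<omega>)"
      unfolding W by (rule sum.mono_neutral_cong_left) (use I K in auto)
    ultimately show ?thesis
      by (simp only: sum_distrib_left sum.distrib[symmetric] e_def distrib_right mult.assoc)
  qed
  then show ?thesis
    unfolding lin_span_def using I K by (intro CollectI exI[of _ "I \<union> K"] exI[of _ e]) auto
qed

lemma gaussian_space_L2: "Y \<in> gaussian_space \<Longrightarrow> Y \<in> L2 P"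
  by (simp add: gaussian_space_def)

lemma span_in_gaussian_space: "V \<in> lin_span \<Longrightarrow> V \<in> gaussian_space"
  unfolding gaussian_space_def by (auto intro!: span_L2_char bexI[of _ V] simp: L2_sqnorm_def)

lemma gaussian_space_closed:
  assumes Y: "Y \<in> L2 P" and near: "\<And>e. 0 < e \<Longrightarrow> \<exists>V\<in>gaussian_space. L2_sqnorm P (\<lambda>\<omega>. V \<omega> - Y \<omega>) < e"
  shows "Y \<in> gaussian_space"
  unfolding gaussian_space_def
proof (intro CollectI conjI Y allI impI)
  fix e :: real assume "0 < e"
  then obtain V where V: "V \<in> gaussian_space" "L2_sqnorm P (\<lambda>\<omega>. V \<omega> - Y \<omega>) < e / 4"
    using near[of "e / 4"] by auto
  then obtain W where W: "W \<in> lin_span" "L2_sqnorm P (\<lambda>\<omega>. W \<omega> - V \<omega>) < e / 4"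
    using \<open>0 < e\<close> unfolding gaussian_space_def by (auto dest!: spec[of _ "e / 4"])
  have "L2_sqnorm P (\<lambda>\<omega>. (W \<omega> - V \<omega>) + (V \<omega> - Y \<omega>)) < e"
    using L2_sqnorm_add_le[OF L2_diff[OF span_L2_char(1)[OF W(1)] gaussian_space_L2[OF V(1)]]
        L2_diff[OF gaussian_space_L2[OF V(1)] Y]] V(2) W(2) by linarith
  then show "\<exists>V\<in>lin_span. L2_sqnorm P (\<lambda>\<omega>. V \<omega> - Y \<omega>) < e" using W(1) by auto
qed

lemma gaussian_space_add_scaled:
  assumes X: "X \<in> gaussian_space" and Y: "Y \<in> gaussian_space"
  shows "(\<lambda>\<omega>. X \<omega> + a * Y \<omega>) \<in> gaussian_space"
proof (rule gaussian_space_closed)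
  note L = gaussian_space_L2[OF X] gaussian_space_L2[OF Y]
  show "(\<lambda>\<omega>. X \<omega> + a * Y \<omega>) \<in> L2 P" by (intro L2_add L2_cmult L)
  fix e :: real assume e: "0 < e"
  define e' where "e' = e / (2 + 2 * a\<^sup>2)"
  have pos: "0 < 2 + 2 * a\<^sup>2" by (rule add_pos_nonneg) auto
  then have e': "0 < e'" "e' * (2 + 2 * a\<^sup>2) = e" using e by (auto simp: e'_def)
  obtain V where V: "V \<in> lin_span" "L2_sqnorm P (\<lambda>\<omega>. V \<omega> - X \<omega>) < e'"
    using X e' unfolding gaussian_space_def by blast
  obtain W where W: "W \<in> lin_span" "L2_sqnorm P (\<lambda>\<omega>. W \<omega> - Y \<omega>) < e'"
    using Y e' unfolding gaussian_space_def by blast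
  have "L2_sqnorm P (\<lambda>\<omega>. (V \<omega> - X \<omega>) + a * (W \<omega> - Y \<omega>)) \<le>
      2 * L2_sqnorm P (\<lambda>\<omega>. V \<omega> - X \<omega>) + 2 * L2_sqnorm P (\<lambda>\<omega>. a * (W \<omega> - Y \<omega>))"
    by (intro L2_sqnorm_add_le L2_cmult L2_diff L span_L2_char V W)
  also have "\<dots> = 2 * L2_sqnorm P (\<lambda>\<omega>. V \<omega> - X \<omega>) + 2 * a\<^sup>2 * L2_sqnorm P (\<lambda>\<omega>. W \<omega> - Y \<omega>)"
    by (simp add: L2_sqnorm_cmult)
  also have "\<dots> < 2 * e' + 2 * a\<^sup>2 * e'"
    using V(2) W(2) by (intro add_less_le_mono mult_left_mono) auto
  also have "\<dots> = e" using e'(2) by (simp add: algebra_simps)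
  finally show "\<exists>U\<in>gaussian_space. L2_sqnorm P (\<lambda>\<omega>. U \<omega> - (X \<omega> + a * Y \<omega>)) < e"
    by (intro bexI[of _ "\<lambda>\<omega>. V \<omega> + a * W \<omega>"] span_in_gaussian_space span_add_scaled V W)
       (simp add: algebra_simps)
qed

lemma gaussian_space_lincomb:
  assumes "Y0 \<in> gaussian_space" "\<And>i. i \<in> K \<Longrightarrow> Y i \<in> gaussian_space"
  shows "(\<lambda>\<omega>. s * Y0 \<omega> + (\<Sum>i\<in>K. \<xi> i * Y i \<omega>)) \<in> gaussian_space"
  using assms(2)
proof (induction K rule: infinite_finite_induct)
  case (insert i K)
  then have "(\<lambda>\<omega>. (s * Y0 \<omega> + (\<Sum>i\<in>K. \<xi> i * Y i \<omega>)) + \<xi> i * Y i \<omega>) \<in> gaussian_space"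
    by (intro gaussian_space_add_scaled) auto
  then show ?case using insert.hyps by (simp add: algebra_simps)
next
  have "(\<lambda>\<omega>. Y0 \<omega> + (s - 1) * Y0 \<omega>) \<in> gaussian_space"
    by (intro gaussian_space_add_scaled assms)
  then have s: "(\<lambda>\<omega>. s * Y0 \<omega>) \<in> gaussian_space" by (simp add: algebra_simps)
  { case (infinite A) show ?case using s infinite by simp }
  { case empty show ?case using s by simp }
qed

text \<open>
  Characteristic functions and variances are both continuous under convergence in \<open>L\<^sup>2\<close>, so the Gaussian
  form passes from the span to its closure.
\<close>

lemma gaussian_space_char:
  assumes Y: "Y \<in> gaussian_space"
  shows "(\<integral>\<omega>. iexp (Y \<omega>) \<partial>P) = exp (- L2_sqnorm P Y / 2)"
proof -
  note YL = gaussian_space_L2[OF Y]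
  have "\<forall>k. \<exists>V\<in>lin_span. L2_sqnorm P (\<lambda>\<omega>. V \<omega> - Y \<omega>) < inverse (real (Suc k))"
    using Y unfolding gaussian_space_def by simp
  then obtain V where V: "\<And>k. V k \<in> lin_span" and Vk: "\<And>k. L2_sqnorm P (\<lambda>\<omega>. V k \<omega> - Y \<omega>) < inverse (real (Suc k))"
    by metis
  note VL = span_L2_char(1)[OF V]
  note [measurable] = L2_measurable[OF YL] L2_measurable[OF VL]
  have lim: "(\<lambda>k. L2_sqnorm P (\<lambda>\<omega>. V k \<omega> - Y \<omega>)) \<longlonglongrightarrow> 0"
    by (rule tendsto_sandwich[OF _ _ tendsto_const LIMSEQ_inverse_real_of_nat])
       (auto intro!: always_eventually less_imp_le Vk simp: L2_sqnorm_nonneg simp del: of_nat_Suc)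
  have "(\<lambda>k. L2_sqnorm P (V k)) \<longlonglongrightarrow> L2_sqnorm P Y"
    using L2_inner_tendsto[OF VL YL VL YL lim lim] by (simp add: L2_sqnorm_mult)
  then have "(\<lambda>k. complex_of_real (exp (- L2_sqnorm P (V k) / 2))) \<longlonglongrightarrow> complex_of_real (exp (- L2_sqnorm P Y / 2))"
    by (intro tendsto_intros) auto
  then have rhs: "(\<lambda>k. \<integral>\<omega>. iexp (V k \<omega>) \<partial>P) \<longlonglongrightarrow> exp (- L2_sqnorm P Y / 2)"
    unfolding span_L2_char(2)[OF V] .
  have int: "integrable P (\<lambda>\<omega>. iexp (f \<omega>))" if [measurable]: "f \<in> borel_measurable P" for f
    by (rule P.integrable_const_bound[of _ 1]) auto
  have "(\<lambda>k. (\<integral>\<omega>. iexp (V k \<omega>) \<partial>P) - (\<integral>\<omega>. iexp (Y \<omega>) \<partial>P)) \<longlonglongrightarrow> 0"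
  proof (rule Lim_null_comparison)
    show "(\<lambda>k. sqrt (L2_sqnorm P (\<lambda>\<omega>. V k \<omega> - Y \<omega>))) \<longlonglongrightarrow> 0"
      using tendsto_real_sqrt[OF lim] by simp
    show "\<forall>\<^sub>F k in sequentially. norm ((\<integral>\<omega>. iexp (V k \<omega>) \<partial>P) - (\<integral>\<omega>. iexp (Y \<omega>) \<partial>P))
        \<le> sqrt (L2_sqnorm P (\<lambda>\<omega>. V k \<omega> - Y \<omega>))"
    proof (rule always_eventually, rule allI)
      fix k
      have dL: "(\<lambda>\<omega>. \<bar>V k \<omega> - Y \<omega>\<bar>) \<in> L2 P" using L2_diff[OF VL YL] by (auto simp: L2_def)
      have one: "(\<lambda>\<omega>. 1::real) \<in> L2 P" by (rule L2_bounded[of _ _ 1]) (auto intro: P.finite_measure_axioms)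
      have "norm ((\<integral>\<omega>. iexp (V k \<omega>) \<partial>P) - (\<integral>\<omega>. iexp (Y \<omega>) \<partial>P)) = norm (\<integral>\<omega>. iexp (V k \<omega>) - iexp (Y \<omega>) \<partial>P)"
        by (subst Bochner_Integration.integral_diff) (auto intro!: int)
      also have "\<dots> \<le> (\<integral>\<omega>. norm (iexp (V k \<omega>) - iexp (Y \<omega>)) \<partial>P)"
        by (rule integral_norm_bound)
      also have "\<dots> \<le> (\<integral>\<omega>. \<bar>V k \<omega> - Y \<omega>\<bar> \<partial>P)"
        by (intro integral_mono integrable_norm Bochner_Integration.integrable_diff int cmod_iexp_diff_le
            L2_integrable[OF P.finite_measure_axioms dL]) auto
      also have "\<dots> \<le> sqrt (L2_sqnorm P (\<lambda>\<omega>. \<bar>V k \<omega> - Y \<omega>\<bar>)) * sqrt (L2_sqnorm P (\<lambda>\<omega>. 1::real))"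
        using L2_cauchy_schwarz_abs[OF dL one] by simp
      also have "\<dots> = sqrt (L2_sqnorm P (\<lambda>\<omega>. V k \<omega> - Y \<omega>))"
        by (simp add: L2_sqnorm_def P.prob_space)
      finally show "norm ((\<integral>\<omega>. iexp (V k \<omega>) \<partial>P) - (\<integral>\<omega>. iexp (Y \<omega>) \<partial>P))
        \<le> sqrt (L2_sqnorm P (\<lambda>\<omega>. V k \<omega> - Y \<omega>))" .
    qed
  qed
  then have "(\<lambda>k. \<integral>\<omega>. iexp (V k \<omega>) \<partial>P) \<longlonglongrightarrow> (\<integral>\<omega>. iexp (Y \<omega>) \<partial>P)"
    by (rule LIM_zero_cancel)
  from LIMSEQ_unique[OF this rhs] show ?thesis .
qed

lemma Z_pair_L2: "(\<lambda>(\<omega>, t). Z t \<omega>) \<in> L2 (P \<Otimes>\<^sub>M \<mu>)"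
proof -
  note [measurable] = Z_pair_measurable
  have m: "(\<lambda>(t, \<omega>). (Z t \<omega>)\<^sup>2) \<in> borel_measurable (\<mu> \<Otimes>\<^sub>M P)"
    using measurable_compose[OF measurable_pair_swap' Z_pair_measurable]
    by (simp add: case_prod_unfold)
  interpret swap: pair_sigma_finite \<mu> P ..
  have "integrable (\<mu> \<Otimes>\<^sub>M P) (\<lambda>(t, \<omega>). (Z t \<omega>)\<^sup>2)"
  proof (rule swap.Fubini_integrable[OF m], goal_cases)
    case 1
    show ?case using trace by (simp add: cov_def power2_eq_square)
  next
    case 2
    show ?case using L2_sq_integrable[OF Z_L2] by (intro AE_I2) simp
  qed
  then have "integrable (P \<Otimes>\<^sub>M \<mu>) (\<lambda>(\<omega>, t). (Z t \<omega>)\<^sup>2)"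
    using PM.integrable_product_swap_iff[of "\<lambda>(\<omega>, t). (Z t \<omega>)\<^sup>2"] by (simp add: case_prod_unfold)
  then show ?thesis by (simp add: L2_def Z_pair_measurable case_prod_unfold)
qed

lemma Z_sections_L2: "AE \<omega> in P. (\<lambda>t. Z t \<omega>) \<in> L2 \<mu>"
  and sqnorm_Z_integrable: "integrable P (\<lambda>\<omega>. L2_sqnorm \<mu> (\<lambda>t. Z t \<omega>))"
proof -
  note [measurable] = Z_pair_measurable
  have i: "integrable (P \<Otimes>\<^sub>M \<mu>) (\<lambda>(\<omega>, t). (Z t \<omega>)\<^sup>2)"
    using L2_sq_integrable[OF Z_pair_L2] by (simp add: case_prod_unfold)
  have "AE \<omega> in P. integrable \<mu> (\<lambda>t. (Z t \<omega>)\<^sup>2)"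
    using PM.AE_integrable_fst[OF i] by simp
  then show "AE \<omega> in P. (\<lambda>t. Z t \<omega>) \<in> L2 \<mu>"
    using AE_space
  proof eventually_elim
    case (elim \<omega>)
    then show ?case using measurable_Pair2[OF Z_pair_measurable, of \<omega>] by (simp add: L2_def)
  qed
  show "integrable P (\<lambda>\<omega>. L2_sqnorm \<mu> (\<lambda>t. Z t \<omega>))"
    using PM.integrable_fst[OF i] by (simp add: L2_sqnorm_def)
qed

lemma smoothed_L2:
  assumes h: "h \<in> L2 \<mu>"
  shows "smoothed \<mu> Z h \<in> L2 P"
proof -
  note [measurable] = Z_pair_measurable L2_measurable[OF h]
  have m [measurable]: "smoothed \<mu> Z h \<in> borel_measurable P"
    unfolding smoothed_def[abs_def] by measurable
  have "integrable P (\<lambda>\<omega>. (smoothed \<mu> Z h \<omega>)\<^sup>2)"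
  proof (rule Bochner_Integration.integrable_bound)
    show "integrable P (\<lambda>\<omega>. L2_sqnorm \<mu> (\<lambda>t. Z t \<omega>) * L2_sqnorm \<mu> h)"
      by (intro integrable_mult_left sqnorm_Z_integrable)
    show "AE \<omega> in P. norm ((smoothed \<mu> Z h \<omega>)\<^sup>2) \<le> norm (L2_sqnorm \<mu> (\<lambda>t. Z t \<omega>) * L2_sqnorm \<mu> h)"
      using Z_sections_L2
      by eventually_elim (use L2_cauchy_schwarz[OF _ h] in \<open>auto simp: smoothed_def abs_of_nonneg L2_sqnorm_nonneg\<close>)
  qed measurable
  then show ?thesis by (simp add: L2_def)
qed

text \<open>
  Integration against \<open>Y\<close> commutes with the time integral. This Fubini identity is the common source of
  the isometry, of the formula for \<open>\<Gamma>\<close>, and of the fact that \<open>smoothed \<mu> Z h\<close> is orthogonal to everything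
  orthogonal to all the \<open>Z t\<close>.
\<close>

lemma smoothed_adjoint:
  assumes Y: "Y \<in> L2 P" and h: "h \<in> L2 \<mu>"
  shows "integrable \<mu> (\<lambda>t. h t * (\<integral>\<omega>. Y \<omega> * Z t \<omega> \<partial>P))"
    and "(\<integral>\<omega>. Y \<omega> * smoothed \<mu> Z h \<omega> \<partial>P) = (\<integral>t. h t * (\<integral>\<omega>. Y \<omega> * Z t \<omega> \<partial>P) \<partial>\<mu>)"
proof -
  note [measurable] = Z_pair_measurable L2_measurable[OF h] L2_measurable[OF Y]
  have "integrable (P \<Otimes>\<^sub>M \<mu>) (\<lambda>(\<omega>, t). (Y \<omega>)\<^sup>2 * (h t)\<^sup>2)"
    by (rule PM.Fubini_integrable)
       (use L2_sq_integrable[OF Y] L2_sq_integrable[OF h] in auto)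
  then have "(\<lambda>(\<omega>, t). Y \<omega> * h t) \<in> L2 (P \<Otimes>\<^sub>M \<mu>)"
    by (simp add: L2_def case_prod_unfold power_mult_distrib)
  from L2_mult_integrable[OF this Z_pair_L2]
  have i: "integrable (P \<Otimes>\<^sub>M \<mu>) (\<lambda>(\<omega>, t). h t * (Y \<omega> * Z t \<omega>))"
    by (simp add: case_prod_unfold mult_ac)
  show "integrable \<mu> (\<lambda>t. h t * (\<integral>\<omega>. Y \<omega> * Z t \<omega> \<partial>P))"
    using PM.integrable_snd[OF i] by simp
  have "(\<integral>\<omega>. Y \<omega> * smoothed \<mu> Z h \<omega> \<partial>P) = (\<integral>\<omega>. (\<integral>t. h t * (Y \<omega> * Z t \<omega>) \<partial>\<mu>) \<partial>P)"
    unfolding smoothed_def integral_mult_right_zero[symmetric] by (simp add: mult_ac)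
  also have "\<dots> = (\<integral>t. (\<integral>\<omega>. h t * (Y \<omega> * Z t \<omega>) \<partial>P) \<partial>\<mu>)"
    by (rule PM.Fubini_integral[OF i, symmetric])
  finally show "(\<integral>\<omega>. Y \<omega> * smoothed \<mu> Z h \<omega> \<partial>P) = (\<integral>t. h t * (\<integral>\<omega>. Y \<omega> * Z t \<omega> \<partial>P) \<partial>\<mu>)"
    by simp
qed

text \<open>
  By \<open>smoothed_adjoint\<close>, a variable orthogonal to all \<open>Z t\<close> is orthogonal to \<open>S = smoothed \<mu> Z h\<close>. If \<open>V\<close> were the
  projection of \<open>S\<close> onto the closed span, then \<open>S - V\<close> would be orthogonal to \<open>V\<close> and to \<open>S\<close>, hence zero.
  The proof is a quantitative version of this with a near minimiser \<open>V\<close> in the span itself, for which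
  \<open>S - V\<close> is orthogonal to the span up to an arbitrarily small factor \<open>\<delta>\<close>.
\<close>

lemma smoothed_in_gaussian_space:
  assumes h: "h \<in> L2 \<mu>"
  shows "smoothed \<mu> Z h \<in> gaussian_space"
proof -
  define S where "S = smoothed \<mu> Z h"
  have S: "S \<in> L2 P" unfolding S_def by (rule smoothed_L2[OF h])
  define d where "d V = L2_sqnorm P (\<lambda>\<omega>. S \<omega> - V \<omega>)" for V
  define m where "m = (INF V\<in>lin_span. d V)"
  define \<tau> where "\<tau> t = sqrt (cov P Z t t)" for t
  have bdd: "bdd_below (d ` lin_span)"
    by (rule bdd_belowI2[of _ 0]) (simp add: d_def L2_sqnorm_nonneg)
  have zero: "(\<lambda>_. 0) \<in> lin_span"
    unfolding lin_span_def by (intro CollectI exI[of _ "{}"]) auto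
  have m_le: "m \<le> d V" if "V \<in> lin_span" for V
    unfolding m_def by (rule cINF_lower[OF bdd that])
  have cov_nonneg: "0 \<le> cov P Z t t" for t
    unfolding cov_def by (rule Bochner_Integration.integral_nonneg) simp
  have [measurable]: "(\<lambda>t. cov P Z t t) \<in> borel_measurable \<mu>" using trace by (rule borel_measurable_integrable)
  have \<tau>: "\<tau> \<in> L2 \<mu>"
    using trace cov_nonneg by (simp add: L2_def \<tau>_def[abs_def])
  have absh: "(\<lambda>t. \<bar>h t\<bar>) \<in> L2 \<mu>" using h by (auto simp: L2_def)
  define A where "A = (\<integral>t. \<bar>h t\<bar> * \<tau> t \<partial>\<mu>)"
  have A_int: "integrable \<mu> (\<lambda>t. \<bar>h t\<bar> * \<tau> t)" by (rule L2_mult_integrable[OF absh \<tau>])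
  have A0: "0 \<le> A" unfolding A_def \<tau>_def by (rule Bochner_Integration.integral_nonneg) (simp add: cov_nonneg)
  define B where "B = sqrt (4 * d (\<lambda>_. 0) + 2)"
  have B0: "0 < B" unfolding B_def d_def using L2_sqnorm_nonneg[of P S] by simp
  \<comment> \<open>\<open>\<delta> A\<close> bounds the inner product of \<open>S - V\<close> with \<open>S\<close>, and \<open>\<delta> B\<close> that with \<open>V\<close>, as \<open>B\<close> bounds the norm of \<open>V\<close>;
     the term \<open>\<delta> \<delta>\<close> only makes the inequality strict.\<close>
  have almost: "d V < \<delta> * (A + B) + \<delta> * \<delta>" if V: "V \<in> lin_span" and dV: "d V < m + \<delta>\<^sup>2" and \<delta>: "0 < \<delta>" "\<delta> \<le> 1" for V \<delta>
  proof -
    note VL = span_L2_char(1)[OF V]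
    have SV: "(\<lambda>\<omega>. S \<omega> - V \<omega>) \<in> L2 P" by (intro L2_diff S VL)
    have orth: "\<bar>\<integral>\<omega>. (S \<omega> - V \<omega>) * W \<omega> \<partial>P\<bar> \<le> \<delta> * sqrt (L2_sqnorm P W)" if W: "W \<in> lin_span" for W
    proof -
      note WL = span_L2_char(1)[OF W]
      have "(\<integral>\<omega>. (S \<omega> - V \<omega>) * W \<omega> \<partial>P)\<^sup>2 \<le> (d V - m) * L2_sqnorm P W"
      proof (rule quadratic_nonneg_imp_sq_le[OF _ L2_sqnorm_nonneg])
        fix c
        have "m \<le> d (\<lambda>\<omega>. V \<omega> + (- c) * W \<omega>)" by (intro m_le span_add_scaled V W)
        also have "\<dots> = L2_sqnorm P (\<lambda>\<omega>. (S \<omega> - V \<omega>) + c * W \<omega>)" by (simp add: d_def algebra_simps)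
        also have "\<dots> = d V + 2 * c * (\<integral>\<omega>. (S \<omega> - V \<omega>) * W \<omega> \<partial>P) + c\<^sup>2 * L2_sqnorm P W"
          unfolding d_def by (rule L2_sqnorm_add_scaled[OF SV WL])
        finally show "0 \<le> d V - m + 2 * c * (\<integral>\<omega>. (S \<omega> - V \<omega>) * W \<omega> \<partial>P) + c\<^sup>2 * L2_sqnorm P W" by simp
      qed
      also have "\<dots> \<le> \<delta>\<^sup>2 * L2_sqnorm P W"
        using dV by (intro mult_right_mono L2_sqnorm_nonneg) simp
      finally have "sqrt ((\<integral>\<omega>. (S \<omega> - V \<omega>) * W \<omega> \<partial>P)\<^sup>2) \<le> sqrt (\<delta>\<^sup>2 * L2_sqnorm P W)" by (rule real_sqrt_le_mono)
      then show ?thesis using \<delta> by (simp add: real_sqrt_mult)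
    qed
    have "(\<integral>\<omega>. (S \<omega> - V \<omega>) * S \<omega> \<partial>P) = (\<integral>t. h t * (\<integral>\<omega>. (S \<omega> - V \<omega>) * Z t \<omega> \<partial>P) \<partial>\<mu>)"
      using smoothed_adjoint(2)[OF SV h] by (simp add: S_def)
    also have "\<dots> \<le> (\<integral>t. \<delta> * (\<bar>h t\<bar> * \<tau> t) \<partial>\<mu>)"
    proof (rule integral_mono)
      show "integrable \<mu> (\<lambda>t. h t * (\<integral>\<omega>. (S \<omega> - V \<omega>) * Z t \<omega> \<partial>P))" by (rule smoothed_adjoint(1)[OF SV h])
      show "integrable \<mu> (\<lambda>t. \<delta> * (\<bar>h t\<bar> * \<tau> t))" by (intro integrable_mult_right A_int)
      fix t assume t: "t \<in> space \<mu>"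
      have "h t * (\<integral>\<omega>. (S \<omega> - V \<omega>) * Z t \<omega> \<partial>P) \<le> \<bar>h t\<bar> * \<bar>\<integral>\<omega>. (S \<omega> - V \<omega>) * Z t \<omega> \<partial>P\<bar>"
        by (metis abs_ge_self abs_mult)
      also have "\<dots> \<le> \<bar>h t\<bar> * (\<delta> * \<tau> t)"
        using orth[OF Z_in_span[OF t]] by (intro mult_left_mono) (auto simp: \<tau>_def cov_def L2_sqnorm_mult)
      finally show "h t * (\<integral>\<omega>. (S \<omega> - V \<omega>) * Z t \<omega> \<partial>P) \<le> \<delta> * (\<bar>h t\<bar> * \<tau> t)" by (simp add: mult_ac)
    qed
    also have "\<dots> = \<delta> * A" by (simp add: A_def)
    finally have 1: "(\<integral>\<omega>. (S \<omega> - V \<omega>) * S \<omega> \<partial>P) \<le> \<delta> * A" .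
    have "L2_sqnorm P V \<le> 2 * L2_sqnorm P S + 2 * d V"
    proof -
      have "d V = L2_sqnorm P (\<lambda>\<omega>. V \<omega> - S \<omega>)" unfolding d_def L2_sqnorm_def by (simp add: power2_commute)
      then show ?thesis using L2_sqnorm_add_le[OF S L2_diff[OF VL S]] by simp
    qed
    also have "\<dots> \<le> 4 * d (\<lambda>_. 0) + 2"
    proof -
      have "\<delta>\<^sup>2 \<le> 1" using \<delta> by (simp add: power_le_one)
      then show ?thesis using dV m_le[OF zero] by (simp add: d_def)
    qed
    finally have "sqrt (L2_sqnorm P V) \<le> B" unfolding B_def by simp
    then have "\<bar>\<integral>\<omega>. (S \<omega> - V \<omega>) * V \<omega> \<partial>P\<bar> \<le> \<delta> * B"
      using orth[OF V] \<delta> by (meson less_imp_le mult_left_mono order_trans)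
    moreover have "d V = (\<integral>\<omega>. (S \<omega> - V \<omega>) * S \<omega> \<partial>P) - (\<integral>\<omega>. (S \<omega> - V \<omega>) * V \<omega> \<partial>P)"
      unfolding d_def L2_sqnorm_mult
      using L2_mult_integrable[OF SV S] L2_mult_integrable[OF SV VL]
      by (simp add: Bochner_Integration.integral_diff[symmetric] algebra_simps del: Bochner_Integration.integral_diff)
    moreover have "0 < \<delta> * \<delta>" using \<delta> by simp
    ultimately show ?thesis using 1 by (simp add: distrib_left)
  qed
  have "\<exists>V\<in>lin_span. L2_sqnorm P (\<lambda>\<omega>. V \<omega> - S \<omega>) < e" if "0 < e" for e
  proof -
    define \<delta> where "\<delta> = min 1 (e / (A + B + 1))"
    have AB: "0 < A + B + 1" using A0 B0 by simp
    have \<delta>: "0 < \<delta>" "\<delta> \<le> 1" using \<open>0 < e\<close> AB by (auto simp: \<delta>_def)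
    have "Inf (d ` lin_span) < m + \<delta>\<^sup>2" using \<delta> by (simp add: m_def)
    then obtain V where V: "V \<in> lin_span" "d V < m + \<delta>\<^sup>2"
      using zero by (subst (asm) cINF_less_iff[OF _ bdd]) auto
    have "d V < \<delta> * (A + B) + \<delta> * \<delta>" by (rule almost[OF V \<delta>])
    also have "\<dots> \<le> \<delta> * (A + B + 1)" using \<delta> mult_left_mono[of \<delta> 1 \<delta>] by (simp add: distrib_left)
    also have "\<dots> \<le> e / (A + B + 1) * (A + B + 1)" using AB by (intro mult_right_mono) (auto simp: \<delta>_def)
    also have "\<dots> = e" using AB by simp
    finally have "d V < e" .
    moreover have "d V = L2_sqnorm P (\<lambda>\<omega>. V \<omega> - S \<omega>)" unfolding d_def L2_sqnorm_def by (simp add: power2_commute)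
    ultimately show ?thesis using V(1) by auto
  qed
  with S show ?thesis unfolding gaussian_space_def S_def by blast
qed

end

section \<open>The isonormal process and its gradient\<close>

locale isonormal_noise = gaussian_noise P \<mu> Z
  for P :: "'w measure" and \<mu> :: "real measure" and Z :: "real \<Rightarrow> 'w \<Rightarrow> real" +
  fixes J :: "(real \<Rightarrow> real) \<Rightarrow> 'h::{real_inner,banach,second_countable_topology}"
  assumes H: "is_H_space \<mu> (cov P Z) J"
begin

abbreviation Iso :: "'h \<Rightarrow> 'w \<Rightarrow> real" where
  "Iso \<equiv> isonormal P \<mu> Z J"

abbreviation \<Gamma> :: "'h \<Rightarrow> real \<Rightarrow> real" where
  "\<Gamma> \<equiv> Gamma_ext P \<mu> Z J"

lemma J_add: "f \<in> L2 \<mu> \<Longrightarrow> g \<in> L2 \<mu> \<Longrightarrow> J (\<lambda>t. f t + g t) = J f + J g"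
  and J_scale: "f \<in> L2 \<mu> \<Longrightarrow> J (\<lambda>t. a * f t) = a *\<^sub>R J f"
  and J_inner: "f \<in> L2 \<mu> \<Longrightarrow> g \<in> L2 \<mu> \<Longrightarrow> J f \<bullet> J g = (\<integral>t. f t * Gamma_op \<mu> (cov P Z) g t \<partial>\<mu>)"
  and J_dense: "closure (J ` L2 \<mu>) = UNIV"
  using H unfolding is_H_space_def by blast+

lemma smoothed_times_Z:
  assumes h: "h \<in> L2 \<mu>" and t: "t \<in> space \<mu>"
  shows "(\<integral>\<omega>. smoothed \<mu> Z h \<omega> * Z t \<omega> \<partial>P) = Gamma_op \<mu> (cov P Z) h t"
proof -
  have "(\<integral>\<omega>. smoothed \<mu> Z h \<omega> * Z t \<omega> \<partial>P) = (\<integral>\<omega>. Z t \<omega> * smoothed \<mu> Z h \<omega> \<partial>P)"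
    by (simp add: mult.commute)
  also have "\<dots> = (\<integral>s. h s * (\<integral>\<omega>. Z t \<omega> * Z s \<omega> \<partial>P) \<partial>\<mu>)"
    by (rule smoothed_adjoint(2)[OF Z_L2[OF t] h])
  finally show ?thesis by (simp add: Gamma_op_def cov_def mult.commute)
qed

lemma smoothed_isometry:
  assumes f: "f \<in> L2 \<mu>" and g: "g \<in> L2 \<mu>"
  shows "(\<integral>\<omega>. smoothed \<mu> Z f \<omega> * smoothed \<mu> Z g \<omega> \<partial>P) = J f \<bullet> J g"
proof -
  have "(\<integral>\<omega>. smoothed \<mu> Z f \<omega> * smoothed \<mu> Z g \<omega> \<partial>P) =
      (\<integral>t. g t * (\<integral>\<omega>. smoothed \<mu> Z f \<omega> * Z t \<omega> \<partial>P) \<partial>\<mu>)"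
    by (rule smoothed_adjoint(2)[OF smoothed_L2[OF f] g])
  also have "\<dots> = (\<integral>t. g t * Gamma_op \<mu> (cov P Z) f t \<partial>\<mu>)"
    by (rule Bochner_Integration.integral_cong) (simp_all add: smoothed_times_Z[OF f])
  also have "\<dots> = J f \<bullet> J g" using J_inner[OF g f] by (simp add: inner_commute)
  finally show ?thesis .
qed

lemma sqnorm_smoothed: "f \<in> L2 \<mu> \<Longrightarrow> L2_sqnorm P (smoothed \<mu> Z f) = (norm (J f))\<^sup>2"
  using smoothed_isometry[of f f] by (simp add: L2_sqnorm_mult power2_norm_eq_inner)

lemma sqnorm_smoothed_diff:
  assumes f: "f \<in> L2 \<mu>" and g: "g \<in> L2 \<mu>"
  shows "L2_sqnorm P (\<lambda>\<omega>. smoothed \<mu> Z f \<omega> - smoothed \<mu> Z g \<omega>) = (norm (J f - J g))\<^sup>2"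
proof -
  have "L2_sqnorm P (\<lambda>\<omega>. smoothed \<mu> Z f \<omega> + (- 1) * smoothed \<mu> Z g \<omega>) =
      (norm (J f))\<^sup>2 - 2 * (J f \<bullet> J g) + (norm (J g))\<^sup>2"
    unfolding L2_sqnorm_add_scaled[OF smoothed_L2[OF f] smoothed_L2[OF g]]
    by (simp add: sqnorm_smoothed f g smoothed_isometry)
  then show ?thesis
    by (simp add: power2_norm_eq_inner inner_diff_left inner_diff_right inner_commute)
qed

lemma ex_approximation: "\<exists>hs. (\<forall>k. hs k \<in> L2 \<mu>) \<and> (\<lambda>k. J (hs k)) \<longlonglongrightarrow> h"
proof -
  have "h \<in> closure (J ` L2 \<mu>)" by (simp add: J_dense)
  then obtain x where x: "\<And>k. x k \<in> J ` L2 \<mu>" "x \<longlonglongrightarrow> h"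
    unfolding closure_sequential by blast
  then have "\<forall>k. \<exists>f. f \<in> L2 \<mu> \<and> x k = J f" by blast
  then obtain hs where hs: "\<And>k. hs k \<in> L2 \<mu>" "\<And>k. x k = J (hs k)" by metis
  from x(2) have "(\<lambda>k. J (hs k)) \<longlonglongrightarrow> h" by (simp add: hs(2)[symmetric])
  with hs(1) show ?thesis by blast
qed

text \<open>
  The isometry makes the images of an approximating sequence a Cauchy sequence. This justifies the choice
  in the definition of \<open>isonormal\<close>.
\<close>

lemma ex_isonormal:
  "\<exists>Y. Y \<in> L2 P \<and> (\<exists>hs. (\<forall>k. hs k \<in> L2 \<mu>) \<and> (\<lambda>k. J (hs k)) \<longlonglongrightarrow> h \<and>
      (\<lambda>k. L2_sqnorm P (\<lambda>\<omega>. smoothed \<mu> Z (hs k) \<omega> - Y \<omega>)) \<longlonglongrightarrow> 0)"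
proof -
  obtain hs where hs: "\<And>k. hs k \<in> L2 \<mu>" "(\<lambda>k. J (hs k)) \<longlonglongrightarrow> h"
    using ex_approximation[of h] by blast
  have "\<exists>Y\<in>L2 P. (\<lambda>k. L2_sqnorm P (\<lambda>\<omega>. smoothed \<mu> Z (hs k) \<omega> - Y \<omega>)) \<longlonglongrightarrow> 0"
  proof (rule L2_complete[OF P.finite_measure_axioms smoothed_L2[OF hs(1)]])
    fix e :: real assume "0 < e"
    moreover have "Cauchy (\<lambda>k. J (hs k))" using hs(2) by (rule LIMSEQ_imp_Cauchy)
    ultimately obtain N where N: "\<forall>m\<ge>N. \<forall>n\<ge>N. norm (J (hs m) - J (hs n)) < sqrt e"
      using CauchyD[of "\<lambda>k. J (hs k)" "sqrt e"] by auto
    have "(norm (J (hs m) - J (hs n)))\<^sup>2 < e" if "m \<ge> N" "n \<ge> N" for m n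
    proof -
      have "(norm (J (hs m) - J (hs n)))\<^sup>2 < (sqrt e)\<^sup>2"
        using N that by (intro power_strict_mono) auto
      then show ?thesis using \<open>0 < e\<close> by simp
    qed
    then show "\<exists>N. \<forall>m\<ge>N. \<forall>n\<ge>N. L2_sqnorm P (\<lambda>\<omega>. smoothed \<mu> Z (hs m) \<omega> - smoothed \<mu> Z (hs n) \<omega>) < e"
      unfolding sqnorm_smoothed_diff[OF hs(1) hs(1)] by blast
  qed
  then show ?thesis using hs by blast
qed

lemma Iso_L2: "Iso h \<in> L2 P"
  using someI_ex[OF ex_isonormal[of h]] unfolding isonormal_def by blast

text \<open>
  The limit does not depend on the approximating sequence: the images of any two of them become
  arbitrarily close, by the isometry.
\<close>

lemma Iso_approx:
  assumes hs: "\<And>k. hs k \<in> L2 \<mu>" and lim: "(\<lambda>k. J (hs k)) \<longlonglongrightarrow> h"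
  shows "(\<lambda>k. L2_sqnorm P (\<lambda>\<omega>. smoothed \<mu> Z (hs k) \<omega> - Iso h \<omega>)) \<longlonglongrightarrow> 0"
proof -
  obtain gs where gs: "\<And>k. gs k \<in> L2 \<mu>" "(\<lambda>k. J (gs k)) \<longlonglongrightarrow> h"
    and gl: "(\<lambda>k. L2_sqnorm P (\<lambda>\<omega>. smoothed \<mu> Z (gs k) \<omega> - Iso h \<omega>)) \<longlonglongrightarrow> 0"
    using someI_ex[OF ex_isonormal[of h]] unfolding isonormal_def by blast
  let ?b = "\<lambda>k. 2 * (norm (J (hs k) - J (gs k)))\<^sup>2 + 2 * L2_sqnorm P (\<lambda>\<omega>. smoothed \<mu> Z (gs k) \<omega> - Iso h \<omega>)"
  have "?b \<longlonglongrightarrow> 2 * (norm (h - h))\<^sup>2 + 2 * 0" by (intro tendsto_intros lim gs(2) gl)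
  then have b: "?b \<longlonglongrightarrow> 0" by simp
  have "L2_sqnorm P (\<lambda>\<omega>. smoothed \<mu> Z (hs k) \<omega> - Iso h \<omega>) \<le> ?b k" for k
    using L2_sqnorm_add_le[OF L2_diff[OF smoothed_L2[OF hs] smoothed_L2[OF gs(1)]]
        L2_diff[OF smoothed_L2[OF gs(1)] Iso_L2], of k k k h]
    by (simp add: sqnorm_smoothed_diff[OF hs gs(1)])
  then show ?thesis
    by (intro tendsto_sandwich[OF _ _ tendsto_const b]) (auto simp: L2_sqnorm_nonneg)
qed

lemma Iso_in_gaussian_space: "Iso h \<in> gaussian_space"
proof (rule gaussian_space_closed[OF Iso_L2])
  fix e :: real assume e: "0 < e"
  obtain hs where hs: "\<And>k. hs k \<in> L2 \<mu>" "(\<lambda>k. J (hs k)) \<longlonglongrightarrow> h"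
    using ex_approximation[of h] by blast
  from order_tendstoD(2)[OF Iso_approx[OF hs] e]
  obtain k where "L2_sqnorm P (\<lambda>\<omega>. smoothed \<mu> Z (hs k) \<omega> - Iso h \<omega>) < e"
    by (auto simp: eventually_sequentially)
  then show "\<exists>V\<in>gaussian_space. L2_sqnorm P (\<lambda>\<omega>. V \<omega> - Iso h \<omega>) < e"
    using smoothed_in_gaussian_space[OF hs(1)] by blast
qed

lemma sqnorm_Iso: "L2_sqnorm P (Iso h) = (norm h)\<^sup>2"
proof -
  obtain hs where hs: "\<And>k. hs k \<in> L2 \<mu>" "(\<lambda>k. J (hs k)) \<longlonglongrightarrow> h"
    using ex_approximation[of h] by blast
  have "(\<lambda>k. (norm (J (hs k)))\<^sup>2) \<longlonglongrightarrow> L2_sqnorm P (Iso h)"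
    using L2_inner_tendsto[OF smoothed_L2[OF hs(1)] Iso_L2 smoothed_L2[OF hs(1)] Iso_L2 Iso_approx[OF hs] Iso_approx[OF hs]]
    by (simp add: L2_sqnorm_mult[symmetric] sqnorm_smoothed hs(1))
  moreover have "(\<lambda>k. (norm (J (hs k)))\<^sup>2) \<longlonglongrightarrow> (norm h)\<^sup>2" by (intro tendsto_intros hs(2))
  ultimately show ?thesis by (rule LIMSEQ_unique)
qed

lemma Gamma_ext_approx:
  assumes t: "t \<in> space \<mu>" and hs: "\<And>k. hs k \<in> L2 \<mu>" "(\<lambda>k. J (hs k)) \<longlonglongrightarrow> h"
  shows "(\<lambda>k. Gamma_op \<mu> (cov P Z) (hs k) t) \<longlonglongrightarrow> \<Gamma> h t"
  using L2_inner_tendsto[OF smoothed_L2[OF hs(1)] Iso_L2 Z_L2[OF t] Z_L2[OF t] Iso_approx[OF hs]]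
  by (simp add: smoothed_times_Z[OF hs(1) t] Gamma_ext_def L2_sqnorm_def)

text \<open>
  On functions, \<open>\<Gamma>\<close> is an integral and so linear; the limit in \<open>Gamma_ext_approx\<close> transfers this to the
  extension, although the versions \<open>Iso h\<close> are chosen separately for each \<open>h\<close>. The bound is the Cauchy-Schwarz
  inequality together with \<open>sqnorm_Iso\<close>.
\<close>

lemma Gamma_ext_bounded_linear:
  assumes t: "t \<in> space \<mu>"
  shows "bounded_linear (\<lambda>h. \<Gamma> h t)"
proof (rule bounded_linear_intro)
  have int: "integrable \<mu> (\<lambda>s. f s * cov P Z s t)" if "f \<in> L2 \<mu>" for f
    using smoothed_adjoint(1)[OF Z_L2[OF t] that] by (simp add: cov_def mult.commute)
  fix x y :: 'h and a :: real
  obtain xs where xs: "\<And>k. xs k \<in> L2 \<mu>" "(\<lambda>k. J (xs k)) \<longlonglongrightarrow> x" using ex_approximation[of x] by blast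
  obtain ys where ys: "\<And>k. ys k \<in> L2 \<mu>" "(\<lambda>k. J (ys k)) \<longlonglongrightarrow> y" using ex_approximation[of y] by blast
  show "\<Gamma> (x + y) t = \<Gamma> x t + \<Gamma> y t"
  proof (rule LIMSEQ_unique)
    show "(\<lambda>k. Gamma_op \<mu> (cov P Z) (\<lambda>s. xs k s + ys k s) t) \<longlonglongrightarrow> \<Gamma> (x + y) t"
    proof (rule Gamma_ext_approx[OF t])
      show "(\<lambda>k. J (\<lambda>s. xs k s + ys k s)) \<longlonglongrightarrow> x + y"
        unfolding J_add[OF xs(1) ys(1)] by (intro tendsto_intros xs ys)
    qed (intro L2_add xs ys)
    have "Gamma_op \<mu> (cov P Z) (\<lambda>s. xs k s + ys k s) t =
        Gamma_op \<mu> (cov P Z) (xs k) t + Gamma_op \<mu> (cov P Z) (ys k) t" for k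
      using int[OF xs(1)[of k]] int[OF ys(1)[of k]] by (simp add: Gamma_op_def distrib_right)
    then show "(\<lambda>k. Gamma_op \<mu> (cov P Z) (\<lambda>s. xs k s + ys k s) t) \<longlonglongrightarrow> \<Gamma> x t + \<Gamma> y t"
      by (simp add: tendsto_add Gamma_ext_approx[OF t xs] Gamma_ext_approx[OF t ys])
  qed
  show "\<Gamma> (a *\<^sub>R x) t = a *\<^sub>R \<Gamma> x t"
  proof (rule LIMSEQ_unique)
    show "(\<lambda>k. Gamma_op \<mu> (cov P Z) (\<lambda>s. a * xs k s) t) \<longlonglongrightarrow> \<Gamma> (a *\<^sub>R x) t"
    proof (rule Gamma_ext_approx[OF t])
      show "(\<lambda>k. J (\<lambda>s. a * xs k s)) \<longlonglongrightarrow> a *\<^sub>R x"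
        unfolding J_scale[OF xs(1)] by (intro tendsto_intros xs)
    qed (intro L2_cmult xs)
    have "Gamma_op \<mu> (cov P Z) (\<lambda>s. a * xs k s) t = a * Gamma_op \<mu> (cov P Z) (xs k) t" for k
      by (simp add: Gamma_op_def mult.assoc)
    then show "(\<lambda>k. Gamma_op \<mu> (cov P Z) (\<lambda>s. a * xs k s) t) \<longlonglongrightarrow> a *\<^sub>R \<Gamma> x t"
      by (simp add: tendsto_mult_left Gamma_ext_approx[OF t xs])
  qed
  show "norm (\<Gamma> x t) \<le> norm x * sqrt (L2_sqnorm P (Z t))"
    using L2_cauchy_schwarz_abs[OF Iso_L2 Z_L2[OF t], of x] by (simp add: Gamma_ext_def sqnorm_Iso)
qed

text \<open>
  Gaussian integration by parts with \<open>Y0 = Z t\<close> and \<open>Y i = Iso (h i)\<close>: the covariances \<open>E[Y0 Y\<^sub>i]\<close> are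
  \<open>\<Gamma> (h i) t\<close> by definition, and linearity of \<open>\<Gamma>\<close> reassembles the gradient.
\<close>

lemma integration_by_parts_cylindrical:
  assumes cyl: "cylindrical_gradient P \<mu> Z J F G" and t: "t \<in> space \<mu>"
  shows "F \<in> L2 P" "G \<in> L2 P" "(\<integral>\<omega>. Z t \<omega> * F \<omega> \<partial>P) = (\<integral>\<omega>. \<Gamma> (G \<omega>) t \<partial>P)"
proof -
  obtain n f h where f: "schwartz n f"
    and F: "F = (\<lambda>\<omega>. f (\<lambda>i. Iso (h i) \<omega>))"
    and G: "G = (\<lambda>\<omega>. \<Sum>i<n. partial_deriv i f (\<lambda>j. Iso (h j) \<omega>) *\<^sub>R h i)"
    using cyl unfolding cylindrical_gradient_def by blast
  interpret \<Gamma>t: bounded_linear "\<lambda>h. \<Gamma> h t" by (rule Gamma_ext_bounded_linear[OF t])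
  have Ym: "(\<lambda>\<omega> i. Iso (h i) \<omega>) \<in> measurable P borel"
    by (rule measurable_coordinatewise_then_product) (rule L2_measurable[OF Iso_L2])
  have comp: "(\<lambda>\<omega>. g (\<lambda>i. Iso (h i) \<omega>)) \<in> L2 P"
    if g: "continuous_on UNIV g" and bounded: "\<exists>C. \<forall>x. \<bar>g x\<bar> \<le> C" for g :: "(nat \<Rightarrow> real) \<Rightarrow> real"
  proof -
    obtain C where C: "\<And>x. \<bar>g x\<bar> \<le> C" using bounded by blast
    show ?thesis
      by (rule L2_bounded[OF P.finite_measure_axioms measurable_compose[OF Ym borel_measurable_continuous_onI[OF g]], of C])
         (simp add: C)
  qed
  show "F \<in> L2 P" unfolding F by (intro comp schwartz_continuous[OF f] schwartz_bounded[OF f])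
  have pd: "(\<lambda>\<omega>. partial_deriv i f (\<lambda>j. Iso (h j) \<omega>)) \<in> L2 P" if "i < n" for i
    by (intro comp schwartz_partial_deriv_continuous[OF f that] schwartz_partial_deriv_bounded[OF f that])
  show "G \<in> L2 P" unfolding G
  proof (rule L2_sum)
    fix i assume "i \<in> {..<n}"
    then have "(\<lambda>\<omega>. partial_deriv i f (\<lambda>j. Iso (h j) \<omega>)) \<in> L2 P" using pd by simp
    then show "(\<lambda>\<omega>. partial_deriv i f (\<lambda>j. Iso (h j) \<omega>) *\<^sub>R h i) \<in> L2 P"
      by (auto simp: L2_def power_mult_distrib)
  qed
  have "(\<integral>\<omega>. Z t \<omega> * F \<omega> \<partial>P) =
      (\<Sum>i<n. (\<integral>\<omega>. Z t \<omega> * Iso (h i) \<omega> \<partial>P) * (\<integral>\<omega>. partial_deriv i f (\<lambda>j. Iso (h j) \<omega>) \<partial>P))"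
    unfolding F
  proof (rule P.gaussian_integration_by_parts[OF Z_L2[OF t] Iso_L2 _ f])
    fix s \<xi> and K :: "nat set"
    show "(\<integral>\<omega>. iexp (s * Z t \<omega> + (\<Sum>i\<in>K. \<xi> i * Iso (h i) \<omega>)) \<partial>P) =
        exp (- L2_sqnorm P (\<lambda>\<omega>. s * Z t \<omega> + (\<Sum>i\<in>K. \<xi> i * Iso (h i) \<omega>)) / 2)"
      by (intro gaussian_space_char gaussian_space_lincomb Iso_in_gaussian_space
          span_in_gaussian_space Z_in_span t)
  qed
  also have "\<dots> = (\<Sum>i<n. \<integral>\<omega>. partial_deriv i f (\<lambda>j. Iso (h j) \<omega>) * \<Gamma> (h i) t \<partial>P)"
    by (simp add: Gamma_ext_def mult.commute)
  also have "\<dots> = (\<integral>\<omega>. (\<Sum>i<n. partial_deriv i f (\<lambda>j. Iso (h j) \<omega>) * \<Gamma> (h i) t) \<partial>P)"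
    by (rule Bochner_Integration.integral_sum[symmetric])
       (auto intro!: integrable_mult_left L2_integrable P.finite_measure_axioms pd)
  also have "\<dots> = (\<integral>\<omega>. \<Gamma> (G \<omega>) t \<partial>P)"
    by (simp add: G \<Gamma>t.sum \<Gamma>t.scaleR)
  finally show "(\<integral>\<omega>. Z t \<omega> * F \<omega> \<partial>P) = (\<integral>\<omega>. \<Gamma> (G \<omega>) t \<partial>P)" .
qed

text \<open>
  Passage to the closure of the graph. The identity holds for every \<open>G\<close> that the closed graph
  associates with \<open>F\<close>, hence for whichever version \<open>nabla\<close> selects.
\<close>

lemma integration_by_parts_gradient:
  assumes grad: "is_gradient P \<mu> Z J F G" and t: "t \<in> space \<mu>"
  shows "integrable P (\<lambda>\<omega>. \<Gamma> (G \<omega>) t)" "(\<integral>\<omega>. Z t \<omega> * F \<omega> \<partial>P) = (\<integral>\<omega>. \<Gamma> (G \<omega>) t \<partial>P)"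
proof -
  obtain Fs Gs where F: "F \<in> L2 P" and G: "G \<in> L2 P"
    and cyl: "\<And>k. cylindrical_gradient P \<mu> Z J (Fs k) (Gs k)"
    and Fl: "(\<lambda>k. L2_sqnorm P (\<lambda>\<omega>. Fs k \<omega> - F \<omega>)) \<longlonglongrightarrow> 0"
    and Gl: "(\<lambda>k. L2_sqnorm P (\<lambda>\<omega>. Gs k \<omega> - G \<omega>)) \<longlonglongrightarrow> 0"
    using grad unfolding is_gradient_def by blast
  interpret \<Gamma>t: bounded_linear "\<lambda>h. \<Gamma> h t" by (rule Gamma_ext_bounded_linear[OF t])
  obtain c where c: "\<And>x. norm (\<Gamma> x t) \<le> norm x * c" using \<Gamma>t.bounded by blast
  have cont: "(\<lambda>h. \<Gamma> h t) \<in> borel_measurable borel"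
    by (intro borel_measurable_continuous_onI \<Gamma>t.continuous_on continuous_on_id)
  have \<Gamma>_L2: "(\<lambda>\<omega>. \<Gamma> (A \<omega>) t) \<in> L2 P" and \<Gamma>_sq: "L2_sqnorm P (\<lambda>\<omega>. \<Gamma> (A \<omega>) t) \<le> c\<^sup>2 * L2_sqnorm P A"
    if A: "A \<in> L2 P" for A
  proof -
    have m: "(\<lambda>\<omega>. \<Gamma> (A \<omega>) t) \<in> borel_measurable P"
      by (rule measurable_compose[OF L2_measurable[OF A] cont])
    have le: "(\<Gamma> x t)\<^sup>2 \<le> c\<^sup>2 * (norm x)\<^sup>2" for x
      using power_mono[OF c[of x], of 2] by (simp add: power_mult_distrib mult.commute)
    have i: "integrable P (\<lambda>\<omega>. c\<^sup>2 * (norm (A \<omega>))\<^sup>2)" by (intro integrable_mult_right L2_sq_integrable A)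
    have i': "integrable P (\<lambda>\<omega>. (\<Gamma> (A \<omega>) t)\<^sup>2)"
      by (rule Bochner_Integration.integrable_bound[OF i]) (use m le in auto)
    then show "(\<lambda>\<omega>. \<Gamma> (A \<omega>) t) \<in> L2 P" using m by (simp add: L2_def)
    have "(\<integral>\<omega>. (\<Gamma> (A \<omega>) t)\<^sup>2 \<partial>P) \<le> (\<integral>\<omega>. c\<^sup>2 * (norm (A \<omega>))\<^sup>2 \<partial>P)"
      by (rule integral_mono[OF i' i le])
    then show "L2_sqnorm P (\<lambda>\<omega>. \<Gamma> (A \<omega>) t) \<le> c\<^sup>2 * L2_sqnorm P A" by (simp add: L2_sqnorm_def)
  qed
  show "integrable P (\<lambda>\<omega>. \<Gamma> (G \<omega>) t)"
    by (rule L2_integrable[OF P.finite_measure_axioms \<Gamma>_L2[OF G]])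
  note FsL = integration_by_parts_cylindrical(1)[OF cyl t] and GsL = integration_by_parts_cylindrical(2)[OF cyl t]
  have one: "(\<lambda>\<omega>. 1::real) \<in> L2 P" by (rule L2_bounded[of _ _ 1]) (auto intro: P.finite_measure_axioms)
  have const: "(\<lambda>k. L2_sqnorm P (\<lambda>\<omega>. f \<omega> - f \<omega>)) \<longlonglongrightarrow> 0" for f :: "'w \<Rightarrow> real"
    by (simp add: L2_sqnorm_def)
  have l: "(\<lambda>k. \<integral>\<omega>. Z t \<omega> * Fs k \<omega> \<partial>P) \<longlonglongrightarrow> (\<integral>\<omega>. Z t \<omega> * F \<omega> \<partial>P)"
    by (rule L2_inner_tendsto[OF Z_L2[OF t] Z_L2[OF t] FsL F const Fl])
  have "(\<lambda>k. L2_sqnorm P (\<lambda>\<omega>. \<Gamma> (Gs k \<omega>) t - \<Gamma> (G \<omega>) t)) \<longlonglongrightarrow> 0"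
  proof (rule tendsto_sandwich[OF _ _ tendsto_const])
    show "(\<lambda>k. c\<^sup>2 * L2_sqnorm P (\<lambda>\<omega>. Gs k \<omega> - G \<omega>)) \<longlonglongrightarrow> 0"
      using tendsto_mult_left[OF Gl, of "c\<^sup>2"] by simp
    show "\<forall>\<^sub>F k in sequentially. L2_sqnorm P (\<lambda>\<omega>. \<Gamma> (Gs k \<omega>) t - \<Gamma> (G \<omega>) t) \<le> c\<^sup>2 * L2_sqnorm P (\<lambda>\<omega>. Gs k \<omega> - G \<omega>)"
      using \<Gamma>_sq[OF L2_diff[OF GsL G]] by (simp add: \<Gamma>t.diff)
  qed (simp add: L2_sqnorm_nonneg)
  then have "(\<lambda>k. \<integral>\<omega>. 1 * \<Gamma> (Gs k \<omega>) t \<partial>P) \<longlonglongrightarrow> (\<integral>\<omega>. 1 * \<Gamma> (G \<omega>) t \<partial>P)"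
    by (intro L2_inner_tendsto one \<Gamma>_L2 GsL G const)
  then have r: "(\<lambda>k. \<integral>\<omega>. Z t \<omega> * Fs k \<omega> \<partial>P) \<longlonglongrightarrow> (\<integral>\<omega>. \<Gamma> (G \<omega>) t \<partial>P)"
    by (simp add: integration_by_parts_cylindrical(3)[OF cyl t])
  from LIMSEQ_unique[OF l r] show "(\<integral>\<omega>. Z t \<omega> * F \<omega> \<partial>P) = (\<integral>\<omega>. \<Gamma> (G \<omega>) t \<partial>P)" .
qed

theorem integration_by_parts:
  assumes F: "F \<in> Dom_nabla P \<mu> Z J" and t: "t \<in> space \<mu>"
  shows "integrable P (D_op P \<mu> Z J t F)" "(\<integral>\<omega>. Z t \<omega> * F \<omega> \<partial>P) = (\<integral>\<omega>. D_op P \<mu> Z J t F \<omega> \<partial>P)"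
proof -
  have "is_gradient P \<mu> Z J F (nabla P \<mu> Z J F)"
    using F unfolding Dom_nabla_def nabla_def mem_Collect_eq by (rule someI_ex)
  from integration_by_parts_gradient[OF this t]
  show "integrable P (D_op P \<mu> Z J t F)" "(\<integral>\<omega>. Z t \<omega> * F \<omega> \<partial>P) = (\<integral>\<omega>. D_op P \<mu> Z J t F \<omega> \<partial>P)"
    by (simp_all add: D_op_def[abs_def])
qed

end

section \<open>The unbiased risk estimate\<close>

theorem proposition3p1:
  fixes T :: real
    and P :: "'w measure"
    and \<mu> :: "real measure"
    and X u Xu \<xi> D\<xi> :: "real \<Rightarrow> 'w \<Rightarrow> real"
    and J :: "(real \<Rightarrow> real) \<Rightarrow> 'h::{real_inner,banach,second_countable_topology}"
  assumes T: "0 < T"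
    and P: "prob_space P"
    and \<mu>: "finite_measure \<mu>" "sets \<mu> = sets (restrict_space borel {0..T})"
    and X: "(\<lambda>(\<omega>, t). X t \<omega>) \<in> borel_measurable (P \<Otimes>\<^sub>M \<mu>)"
    and u: "(\<lambda>(\<omega>, t). u t \<omega>) \<in> borel_measurable (P \<Otimes>\<^sub>M \<mu>)"
    and u_adapted: "\<And>t. t \<in> {0..T} \<Longrightarrow> u t \<in> borel_measurable (natural_filtration P X t)"
    and u_square_integrable: "AE t in \<mu>. integrable P (\<lambda>\<omega>. (u t \<omega>)\<^sup>2)"
    and decomposition: "\<And>t \<omega>. t \<in> {0..T} \<Longrightarrow> \<omega> \<in> space P \<Longrightarrow> X t \<omega> = u t \<omega> + Xu t \<omega>"
    and gaussian: "centered_gaussian_process P {0..T} Xu"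
    and non_vanishing: "\<exists>s\<in>{0..T}. \<exists>t\<in>{0..T}. cov P Xu s t \<noteq> 0"
    and trace: "integrable \<mu> (\<lambda>t. cov P Xu t t)"
    and H: "is_H_space \<mu> (cov P Xu) J"
    and \<xi>_L2: "(\<lambda>(\<omega>, t). \<xi> t \<omega>) \<in> L2 (P \<Otimes>\<^sub>M \<mu>)"
    and \<xi>_Dom: "\<And>t. t \<in> {0..T} \<Longrightarrow> \<xi> t \<in> Dom_nabla P \<mu> Xu J"
    and D\<xi>_version: "AE t in \<mu>. AE \<omega> in P. D\<xi> t \<omega> = D_op P \<mu> Xu J t (\<xi> t) \<omega>"
    and D\<xi>_L1: "integrable (P \<Otimes>\<^sub>M \<mu>) (\<lambda>(\<omega>, t). D\<xi> t \<omega>)"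
  shows "(AE \<omega> in P. (\<lambda>t. X t \<omega> + \<xi> t \<omega> - u t \<omega>) \<in> L2 \<mu>) \<and>
    integrable P (\<lambda>\<omega>. L2_sqnorm \<mu> (\<lambda>t. X t \<omega> + \<xi> t \<omega> - u t \<omega>)) \<and>
    integrable P (SURE \<mu> (cov P Xu) \<xi> D\<xi>) \<and>
    (\<integral>\<omega>. L2_sqnorm \<mu> (\<lambda>t. X t \<omega> + \<xi> t \<omega> - u t \<omega>) \<partial>P) =
      (\<integral>\<omega>. SURE \<mu> (cov P Xu) \<xi> D\<xi> \<omega> \<partial>P)"
proof -
  have space: "space \<mu> = {0..T}"
    using sets_eq_imp_space_eq[OF \<mu>(2)] by (simp add: space_restrict_space)
  have Xu_measurable: "(\<lambda>(\<omega>, t). Xu t \<omega>) \<in> borel_measurable (P \<Otimes>\<^sub>M \<mu>)"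
  proof -
    have "(\<lambda>p. (\<lambda>(\<omega>, t). X t \<omega>) p - (\<lambda>(\<omega>, t). u t \<omega>) p) \<in> borel_measurable (P \<Otimes>\<^sub>M \<mu>)"
      by (intro borel_measurable_diff X u)
    then show ?thesis
      by (rule measurable_cong[THEN iffD1, rotated])
         (auto simp: space_pair_measure space decomposition)
  qed
  interpret P: prob_space P by fact
  interpret \<mu>: finite_measure \<mu> by fact
  interpret isonormal_noise P \<mu> Xu J
    by unfold_locales (use Xu_measurable gaussian trace H space in auto)
  define E where "E = (\<lambda>(\<omega>, t). Xu t \<omega> + \<xi> t \<omega>)"
  have error: "X t \<omega> + \<xi> t \<omega> - u t \<omega> = E (\<omega>, t)" if "\<omega> \<in> space P" "t \<in> space \<mu>" for t \<omega>
    using decomposition[of t \<omega>] that by (simp add: E_def space)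
  have E_L2: "E \<in> L2 (P \<Otimes>\<^sub>M \<mu>)"
    using L2_add[OF Z_pair_L2 \<xi>_L2] by (simp add: E_def case_prod_unfold)
  have E_sq: "integrable (P \<Otimes>\<^sub>M \<mu>) (\<lambda>(\<omega>, t). (E (\<omega>, t))\<^sup>2)"
    using L2_sq_integrable[OF E_L2] by (simp add: case_prod_unfold)
  have \<xi>_sq: "integrable (P \<Otimes>\<^sub>M \<mu>) (\<lambda>(\<omega>, t). (\<xi> t \<omega>)\<^sup>2)"
    using L2_sq_integrable[OF \<xi>_L2] by (simp add: case_prod_unfold)
  have Z_sq: "integrable (P \<Otimes>\<^sub>M \<mu>) (\<lambda>(\<omega>, t). (Xu t \<omega>)\<^sup>2)"
    using L2_sq_integrable[OF Z_pair_L2] by (simp add: case_prod_unfold)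
  have Z\<xi>: "integrable (P \<Otimes>\<^sub>M \<mu>) (\<lambda>(\<omega>, t). Xu t \<omega> * \<xi> t \<omega>)"
    using L2_mult_integrable[OF Z_pair_L2 \<xi>_L2] by (simp add: case_prod_unfold)
  have norm_eq: "L2_sqnorm \<mu> (\<lambda>t. X t \<omega> + \<xi> t \<omega> - u t \<omega>) = (\<integral>t. (E (\<omega>, t))\<^sup>2 \<partial>\<mu>)"
    if "\<omega> \<in> space P" for \<omega>
    unfolding L2_sqnorm_def using that
    by (intro Bochner_Integration.integral_cong) (simp_all add: error)
  have "AE \<omega> in P. (\<lambda>t. X t \<omega> + \<xi> t \<omega> - u t \<omega>) \<in> L2 \<mu>"
    using PM.AE_integrable_fst[OF E_sq] AE_space
  proof eventually_elim
    case (elim \<omega>)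
    have "(\<lambda>t. X t \<omega> + \<xi> t \<omega> - u t \<omega>) \<in> borel_measurable \<mu> \<longleftrightarrow> (\<lambda>t. E (\<omega>, t)) \<in> borel_measurable \<mu>"
      by (rule measurable_cong) (simp add: error elim)
    moreover have "(\<lambda>t. E (\<omega>, t)) \<in> borel_measurable \<mu>"
      by (rule measurable_Pair2[OF L2_measurable[OF E_L2] elim(2)])
    moreover have "integrable \<mu> (\<lambda>t. (X t \<omega> + \<xi> t \<omega> - u t \<omega>)\<^sup>2) \<longleftrightarrow> integrable \<mu> (\<lambda>t. (E (\<omega>, t))\<^sup>2)"
      by (rule Bochner_Integration.integrable_cong) (simp_all add: error elim)
    ultimately show ?case using elim(1) by (simp add: L2_def)
  qed
  moreover have "integrable P (\<lambda>\<omega>. L2_sqnorm \<mu> (\<lambda>t. X t \<omega> + \<xi> t \<omega> - u t \<omega>))"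
    using PM.integrable_fst[OF E_sq] by (simp add: norm_eq cong: Bochner_Integration.integrable_cong)
  moreover have SURE_int: "integrable P (SURE \<mu> (cov P Xu) \<xi> D\<xi>)"
    unfolding SURE_def[abs_def] L2_sqnorm_def
    using PM.integrable_fst[OF \<xi>_sq] PM.integrable_fst[OF D\<xi>_L1] by simp
  moreover have "(\<integral>\<omega>. L2_sqnorm \<mu> (\<lambda>t. X t \<omega> + \<xi> t \<omega> - u t \<omega>) \<partial>P) =
      (\<integral>\<omega>. SURE \<mu> (cov P Xu) \<xi> D\<xi> \<omega> \<partial>P)"
  proof -
    have cross: "(\<integral>\<omega>. Xu t \<omega> * \<xi> t \<omega> \<partial>P) = (\<integral>\<omega>. D\<xi> t \<omega> \<partial>P)"
      if t: "t \<in> space \<mu>" and eq: "AE \<omega> in P. D\<xi> t \<omega> = D_op P \<mu> Xu J t (\<xi> t) \<omega>"  for t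
    proof -
      have Dom: "\<xi> t \<in> Dom_nabla P \<mu> Xu J" using \<xi>_Dom t space by simp
      have "(\<integral>\<omega>. D\<xi> t \<omega> \<partial>P) = (\<integral>\<omega>. D_op P \<mu> Xu J t (\<xi> t) \<omega> \<partial>P)"
      proof (rule integral_cong_AE[OF _ _ eq])
        show "D\<xi> t \<in> borel_measurable P"
          using measurable_Pair1[OF borel_measurable_integrable[OF D\<xi>_L1] t] by simp
        show "D_op P \<mu> Xu J t (\<xi> t) \<in> borel_measurable P"
          by (rule borel_measurable_integrable[OF integration_by_parts(1)[OF Dom t]])
      qed
      then show ?thesis using integration_by_parts(2)[OF Dom t] by simp
    qed
    have fub: "(\<integral>\<omega>. (\<integral>t. f \<omega> t \<partial>\<mu>) \<partial>P) = (\<integral>t. (\<integral>\<omega>. f \<omega> t \<partial>P) \<partial>\<mu>)"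
      "integrable P (\<lambda>\<omega>. \<integral>t. f \<omega> t \<partial>\<mu>)"
      if "integrable (P \<Otimes>\<^sub>M \<mu>) (\<lambda>(\<omega>, t). f \<omega> t)" for f :: "'w \<Rightarrow> real \<Rightarrow> real"
      using PM.Fubini_integral[OF that] PM.integrable_fst[OF that] by simp_all
    have D_int: "(\<integral>t. (\<integral>\<omega>. Xu t \<omega> * \<xi> t \<omega> \<partial>P) \<partial>\<mu>) = (\<integral>t. (\<integral>\<omega>. D\<xi> t \<omega> \<partial>P) \<partial>\<mu>)"
    proof (rule integral_cong_AE)
      show "(\<lambda>t. \<integral>\<omega>. Xu t \<omega> * \<xi> t \<omega> \<partial>P) \<in> borel_measurable \<mu>"
        using PM.integrable_snd[OF Z\<xi>] by simp
      show "(\<lambda>t. \<integral>\<omega>. D\<xi> t \<omega> \<partial>P) \<in> borel_measurable \<mu>"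
        using PM.integrable_snd[OF D\<xi>_L1] by simp
      show "AE t in \<mu>. (\<integral>\<omega>. Xu t \<omega> * \<xi> t \<omega> \<partial>P) = (\<integral>\<omega>. D\<xi> t \<omega> \<partial>P)"
        using D\<xi>_version AE_space by eventually_elim (rule cross)
    qed
    have "(\<integral>\<omega>. L2_sqnorm \<mu> (\<lambda>t. X t \<omega> + \<xi> t \<omega> - u t \<omega>) \<partial>P) = (\<integral>\<omega>. (\<integral>t. (E (\<omega>, t))\<^sup>2 \<partial>\<mu>) \<partial>P)"
      by (rule Bochner_Integration.integral_cong) (simp_all add: norm_eq)
    also have "\<dots> = (\<integral>p. (\<lambda>(\<omega>, t). (Xu t \<omega>)\<^sup>2) p + (\<lambda>(\<omega>, t). (\<xi> t \<omega>)\<^sup>2) p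
        + 2 * (\<lambda>(\<omega>, t). Xu t \<omega> * \<xi> t \<omega>) p \<partial>(P \<Otimes>\<^sub>M \<mu>))"
      using PM.integral_fst[OF E_sq] by (simp add: E_def case_prod_unfold power2_sum algebra_simps)
    also have "\<dots> = (\<integral>(\<omega>, t). (Xu t \<omega>)\<^sup>2 \<partial>(P \<Otimes>\<^sub>M \<mu>)) + (\<integral>(\<omega>, t). (\<xi> t \<omega>)\<^sup>2 \<partial>(P \<Otimes>\<^sub>M \<mu>))
        + 2 * (\<integral>(\<omega>, t). Xu t \<omega> * \<xi> t \<omega> \<partial>(P \<Otimes>\<^sub>M \<mu>))"
      using Z_sq \<xi>_sq Z\<xi> by simp
    also have "\<dots> = (\<integral>t. cov P Xu t t \<partial>\<mu>) + (\<integral>\<omega>. L2_sqnorm \<mu> (\<lambda>t. \<xi> t \<omega>) \<partial>P)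
        + 2 * (\<integral>\<omega>. (\<integral>t. D\<xi> t \<omega> \<partial>\<mu>) \<partial>P)"
    proof -
      have "(\<integral>(\<omega>, t). (Xu t \<omega>)\<^sup>2 \<partial>(P \<Otimes>\<^sub>M \<mu>)) = (\<integral>t. cov P Xu t t \<partial>\<mu>)"
        using PM.integral_snd[OF Z_sq] by (simp add: cov_def power2_eq_square)
      moreover have "(\<integral>(\<omega>, t). (\<xi> t \<omega>)\<^sup>2 \<partial>(P \<Otimes>\<^sub>M \<mu>)) = (\<integral>\<omega>. L2_sqnorm \<mu> (\<lambda>t. \<xi> t \<omega>) \<partial>P)"
        using PM.integral_fst[OF \<xi>_sq] by (simp add: L2_sqnorm_def)
      moreover have "(\<integral>(\<omega>, t). Xu t \<omega> * \<xi> t \<omega> \<partial>(P \<Otimes>\<^sub>M \<mu>)) = (\<integral>\<omega>. (\<integral>t. D\<xi> t \<omega> \<partial>\<mu>) \<partial>P)"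
        using PM.integral_snd[OF Z\<xi>] by (simp add: D_int fub(1)[OF D\<xi>_L1])
      ultimately show ?thesis by simp
    qed
    also have "\<dots> = (\<integral>\<omega>. SURE \<mu> (cov P Xu) \<xi> D\<xi> \<omega> \<partial>P)"
      unfolding SURE_def using fub(2)[OF \<xi>_sq] fub(2)[OF D\<xi>_L1]
      by (simp add: L2_sqnorm_def P.prob_space)
    finally show ?thesis .
  qed
  ultimately show ?thesis by blast
qed

end
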